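(* Let $A$ be an honest participant, and let $\Gamma$ be a concrete BitML configuration reachable, via the concrete semantics $\to_\flat$, from an initial configuration. Let $\mathcal X\subseteq\mathrm{cn}(\Gamma)$, let $(\mathsf X_i)_i$ be a finite family of recursion variables, and assume that $$\alpha_{A,\mathcal X}(\Gamma)\;\big|\;\|_i\,\mathsf X_i\;\to_\sharp^*\;\Gamma'_\sharp\qquad\text{with all labels in }\mathcal L^\sharp .$$ Then there exist a concrete run $\mathcal R$ and a concrete configuration $\Gamma'$ such that $$\mathcal R=\Gamma\to_\flat^*\Gamma'\ \text{ with all labels in }\mathcal L^\flat_A,\qquad\text{and}\qquad \Gamma'_\sharp=\alpha_{A,\mathrm{desc}_\Gamma(\mathcal R,\mathcal X)}(\Gamma')\;\big|\;\|_i\,\mathsf X_i .$$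
   Context: **Syntax.** Fix: participants $P,Q,\dots$, with a subset $\mathrm{Hon}$ of honest participants; a set of names $x,y,z,\dots$ (used both for deposits and for contracts); deposit variables $d,e,\dots$; secret names $a,b,\dots$, with a set $S_P$ of secret names usable by each participant $P$, where $S_P\cap S_Q=\emptyset$ if $P\ne Q$; a finite set of recursion variables $\mathsf X,\mathsf Y,\dots$; integer variables $\beta$. $\chi$ ranges over names and deposit variables; $v,w$ over non-negative rationals. Static expressions $\mathcal E$ are built from integer constants and integer variables with the usual arithmetic operators; a closed one evaluates to an integer $[\![\mathcal E]\!]$. A vector $\vec{\cdot}$ is a finite sequence. A "fresh" name is one not already in use. *Preconditions:* $G ::= P{:}v@\chi \mid P{:}\mathtt{secret}\,a\ (a\in S_P) \mid (G\,|\,G)$, with the $\chi$'s in $G$ distinct. *Contracts:* $C ::= \sum_{i\in I} D_i$ ($I$ finite; $0$ is the empty sum). *Guarded contracts:* $D ::= \mathtt{withdraw}\,P \mid \mathtt{reveal}\,\vec a\ \mathtt{if}\ p\,.\,C \mid \mathtt{split}\,\|_{i}(w_i\to C_i) \mid P{:}D \mid \mathtt{after}\ \mathcal E{:}D \mid {*}{:}\mathtt{rngt}\ \mathsf X\langle\vec{\mathcal E}\rangle$. Predicates: $p ::= \mathit{true}\mid p\wedge p\mid \neg p\mid E=E\mid E<E$, with $E ::= \mathcal E\mid a\mid E+E\mid E-E$. In $\mathtt{reveal}\,\vec a\ \mathtt{if}\ p$ the names $\vec a$ are distinct and include those in $p$. Each $\mathsf X$ has a unique defining equation $\mathsf X(\vec\beta)=\{G\}C$,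 and uses of $\mathsf X$ have the right number of arguments. The order of decorations $P{:}$, $\mathtt{after}\ \mathcal E{:}$ is immaterial. *Advertisements* $\{G\}^{\circ}C$, with $\circ$ empty or a name, satisfy: each secret name in $C$ occurs in $G$; $G$ requires a deposit from each participant in the advertisement; each ${*}{:}\mathtt{rngt}\,\mathsf X\langle\vec{\mathcal E}\rangle$ in $C$ refers to a defining equation $\mathsf X(\vec\beta)=\{G'\}C'$ where $G'$ has the same participants as $G$. *Configurations* are parallel compositions ($|$ with unit $0$, a commutative monoid) of: advertisements $\{G\}^\circ C$; active contracts $\langle C,v\rangle_x$; deposits $\langle P,v\rangle_x$; authorizations $P[\xi]$; committed secrets $\{P{:}a\#N\}$ ($N\in\mathbb N\cup\{\bot\}$); revealed secrets $P{:}a\#N$ ($N\in\mathbb N$); bindings $P{:}d\leftarrow x$; a time term $t$ (at most one occurrence). There are no duplicate authorizations, and two terms $\langle\cdots\rangle_x$, $\langle\cdots\rangle_y$ in a configuration have $x\neq y$. Here $\xi$ is one of: $\#\rhd\{G\}^\circ C$; $x\rhd\{G\}^\circ C$; $x\rhd D$; $x,y\rhd\langle P,v\rangle$; $x\rhd\langle P,v\rangle,\langle P,v'\rangle$; $x\rhd Q$; $\vec x,i\rhd y$. $\mathrm{cn}(\Gamma)$ is the set of $x$ such that $\Gamma$ contains some active contract $\langle C,v\rangle_x$. A configuration is *timed* if it contains a time term; an *initial* configuration consists of deposits only (together with a time term, since runs start from timed configurations). **Concrete semantics** $\Gamma\xrightarrow{\ell}_\flat\Gamma'$ between timed configurations (in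 the rules, $\Gamma$ is an arbitrary remaining part, possibly including $t$; the label is given in brackets): - Deposits. $\langle P,v\rangle_x|\langle P,v'\rangle_y|\Gamma$ adds $P[x,y\rhd\langle P,v+v'\rangle]$ [$P{:}x,y$]; with both $P[x,y\rhd\langle P,v+v'\rangle]$ and $P[y,x\rhd\langle P,v+v'\rangle]$ present, the two deposits and these authorizations are replaced by $\langle P,v+v'\rangle_z$, $z$ fresh [$\mathit{join}(x,y)$]. $\langle P,v+v'\rangle_x$ allows adding $P[x\rhd\langle P,v\rangle,\langle P,v'\rangle]$ [$P{:}x,v,v'$]; with it, deposit and authorization are replaced by $\langle P,v\rangle_y|\langle P,v'\rangle_{y'}$, $y,y'$ fresh [$\mathit{divide}(x,v,v')$]. $\langle P,v\rangle_x$ allows adding $P[x\rhd Q]$ [$P{:}x,Q$]; with it, both are replaced by $\langle Q,v\rangle_y$, $y$ fresh [$\mathit{donate}(x,Q)$]. Given $\|_{i=1}^n\langle P_i,v_i\rangle_{x_i}$, $\vec x=x_1\cdots x_n$, one can add $P_j[\vec x,j\rhd y]$, $y$ fresh except in destroy authorizations for $\vec x$ [$P_j{:}\vec x,j$]; when $P_i[\vec x,i\rhd y]$ are present for all $i$, all these deposits and authorizations are removed [$\mathit{destroy}(\vec x)$]. - C-Adv: if for each $P{:}v@x$ in $G$ ($x$ a name) $\langle P,v\rangle_x$ is in $\Gamma$, and all secrets in $G$ are fresh, then $\Gamma\to\{G\}C|\Gamma$ [$\mathit{adv}(\{G\}C)$]. - C-AuthCommit: $\{G\}^\circ C|\Gamma\to\{G\}^\circ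 C|\Gamma|\Delta_s|\Delta_d|P[\#\rhd\{G\}^\circ C]$ [$P{:}\{G\}^\circ C,\Delta_s|\Delta_d$], where $\Delta_s=\|_{i=1}^k\{P{:}a_i\#N_i\}$ for $a_1,\dots,a_k$ all the secrets of $P$ in $G$, none of which already occurs committed or revealed by $P$ in $\Gamma$, with $N_i\in\mathbb N$ if $P\in\mathrm{Hon}$ and $N_i\in\mathbb N\cup\{\bot\}$ otherwise; $\Delta_d=\|_{i=1}^h P{:}d_i\leftarrow x_i$ for $d_1,\dots,d_h$ all the deposit variables of $P$ in $G$ (with $P{:}v_i@d_i$ in $G$), with no binding of $P$ for $d_i$ in $\Gamma$, $\langle P,v_i\rangle_{x_i}$ in $\Gamma$, the $x_i$ pairwise distinct and different from every name $x$ with $P{:}v@x$ in $G$. - C-AuthInitDep: if $Q[\#\rhd\{G\}^\circ C]$ is in $\Gamma$ for all $Q$ in $G$, and either $P{:}v@\chi$ is in $G$ with $\chi=x$ or ($\chi=d$ and $P{:}d\leftarrow x$ in $\Gamma$), or $\circ=x$ and $P$ occurs in $G$, then $\{G\}^\circ C|\Gamma\to\{G\}^\circ C|\Gamma|P[x\rhd\{G\}^\circ C]$ [$P{:}\{G\}^\circ C,x$]. - C-Init: let $G=(\|_{i\in I}P_i{:}v_i@x_i)|(\|_{i\in J}Q_i{:}v'_i@d_i)|(\|_{i\in K}R_i{:}\mathtt{secret}\,a_i)$, and let $\Delta$ consist of $\langle P_i,v_i\rangle_{x_i}$ and $P_i[x_i\rhd\{G\}C]$ ($i\in I$), of $\langle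 Q_i,v'_i\rangle_{x'_i}$, $Q_i{:}d_i\leftarrow x'_i$ and $Q_i[x'_i\rhd\{G\}C]$ ($i\in J$), and of $P[\#\rhd\{G\}C]$ for all $P$ in $G$. Then $\{G\}C|\Delta|\Gamma\to\langle C,\sum_I v_i+\sum_J v'_i\rangle_z|\Gamma$, $z$ fresh [$\mathit{init}(G,C)$]. - C-Withdraw: $\langle\mathtt{withdraw}\,P,v\rangle_x|\Gamma\to\langle P,v\rangle_y|\Gamma$, $y$ fresh [$\mathit{withdraw}(P,v,x)$]. - C-Split: if $w=\sum_{i=1}^k w_i$, $v_i=(v\cdot w_i)/w$ and $y_1,\dots,y_k$ are fresh, then $\langle\mathtt{split}\,\|_{i=1}^k(w_i\to C_i),v\rangle_x|\Gamma\to\|_{i=1}^k\langle C_i,v_i\rangle_{y_i}|\Gamma$ [$\mathit{split}(x)$]. - C-AuthRev: $\{P{:}a\#N\}|\Gamma\to P{:}a\#N|\Gamma$ if $N\ne\bot$ [$P{:}a$]. - C-Rev: if $\Delta=\|_{i=1}^n Q_i{:}a_i\#N_i$, $\vec a=a_1\cdots a_n$, and $p$ is true when each $a_i$ is evaluated as $N_i$, then $\langle\mathtt{reveal}\,\vec a\ \mathtt{if}\ p.C,v\rangle_x|\Gamma|\Delta\to\langle C,v\rangle_y|\Gamma|\Delta$, $y$ fresh [$\mathit{rev}(\vec a,y)$]. - C-AuthBranch: $\langle P{:}D+C,v\rangle_x|\Gamma\to\langle P{:}D+C,v\rangle_x|P[x\rhd P{:}D]|\Gamma$ [$P{:}(x,P{:}D)$].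 - C-Branch: if $D=P_1{:}\cdots P_k{:}\mathtt{after}\ t_1{:}\cdots\mathtt{after}\ t_m{:}D'$ (the $t_i$ being values of closed static expressions), $D'$ is not of the form $P{:}\cdots$ or $\mathtt{after}\ t'{:}\cdots$, $\langle D',v\rangle_x|\Gamma\xrightarrow{\ell}_\flat\Gamma'$ with $x\notin\mathrm{cn}(\Gamma')$, and $t\ge t_1,\dots,t_m$, then $\langle D+C,v\rangle_x|\,\|_{i=1}^kP_i[x\rhd D]\,|\Gamma|t\xrightarrow{\ell}_\flat\Gamma'|t$. - C-Delay: $\Gamma|t\to\Gamma|t+\delta$ for $\delta>0$ [$\delta$]. - Write $\{G\}C\equiv\mathsf X\langle\vec{\mathcal E}\rangle$ if $\{G\}C$ is $\alpha$-equivalent (w.r.t. secret names and deposit variables) to the advertisement obtained from the defining equation $\mathsf X(\vec\beta)=\{G'\}C'$ by replacing $\vec\beta$ with $[\![\vec{\mathcal E}]\!]$ and evaluating the static expressions. C-AdvRngt: if $\{G\}C\equiv\mathsf X\langle\vec{\mathcal E}\rangle$, the secrets and deposit variables of $G$ are fresh, no $\{G'\}^xC'$ in $\Gamma$ has $\{G'\}C'\equiv\mathsf X\langle\vec{\mathcal E}\rangle$, and each $P{:}v@y$ in $G$ with $y$ a name has $\langle P,v\rangle_y$ in $\Gamma$, then $\langle{*}{:}\mathtt{rngt}\,\mathsf X\langle\vec{\mathcal E}\rangle+C_{alt},v\rangle_x|\Gamma$ adds $\{G\}^xC$ [$\mathit{advRngt}(\{G\}^xC)$]. - C-Rngt: if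 $\{G\}C\equiv\mathsf X\langle\vec{\mathcal E}\rangle$, with $G$ and $\Delta$ as in C-Init but with $\{G\}^xC$ in place of $\{G\}C$ in authorizations and $\Delta$ additionally containing $P[x\rhd\{G\}^xC]$ for all $P$ in $G$, then $\langle{*}{:}\mathtt{rngt}\,\mathsf X\langle\vec{\mathcal E}\rangle+C_{alt},v\rangle_x|\{G\}^xC|\Gamma|\Delta\to\langle C,v+\sum_Iv_i+\sum_Jv'_i\rangle_y|\Gamma$, $y$ fresh [$\mathit{rngt}(x,G,C)$]. $\mathcal L^\flat_A$ is the set of all concrete labels except those of the form $P{:}\cdots$ with $P\ne A$. **Abstraction.** For a participant $A$: $\alpha_A(\sum_iD_i)=\sum_i\alpha_A(D_i)$; $\alpha_A(\mathtt{withdraw}\,P)=\mathtt{withdraw}\,P$; $\alpha_A(\mathtt{reveal}\,\vec a\ \mathtt{if}\ p.C)$ is $\tau.\alpha_A(C)$ if $p=\mathit{true}$ and $\vec a\subseteq S_A$, and ${*}{:}\tau.\alpha_A(C)$ otherwise; $\alpha_A(\mathtt{split}\,\|_i(w_i\to C_i))=\mathtt{split}\,\|_i(\to\alpha_A(C_i))$; $\alpha_A(P{:}D)$ is $\alpha_A(D)$ if $P=A$ and ${*}{:}\alpha_A(D)$ otherwise; $\alpha_A(\mathtt{after}\ \mathcal E{:}D)=\alpha_A(D)$; $\alpha_A({*}{:}\mathtt{rngt}\,\mathsf X\langle\vec{\mathcal E}\rangle)={*}{:}\mathtt{rngt}\,\mathsf X$. Each $\mathsf X(\vec\beta)=\{G\}C$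 is abstracted as $\mathsf X=_\sharp\alpha_A(C)$. For a set $\mathcal X$ of names: $\alpha_{A,\mathcal X}(\Delta|\Delta')=\alpha_{A,\mathcal X}(\Delta)|\alpha_{A,\mathcal X}(\Delta')$; $\alpha_{A,\mathcal X}(\langle C,v\rangle_x)=\langle\alpha_A(C)\rangle_x$ if $x\in\mathcal X$; every other single term is mapped to $0$. Abstract configurations are parallel compositions of terms $\langle C\rangle_x$ ($C$ an abstract contract) and recursion variables $\mathsf X$; $\mathrm{cn}$ is the set of $x$ of its terms $\langle C\rangle_x$. ${*}{:}{*}{:}D$ is identified with ${*}{:}D$. **Abstract semantics** $\xrightarrow{\ell}_\sharp$, with labels $x$ or ${*}{:}x$ (${*}{:}{*}{:}\ell$ identified with ${*}{:}\ell$; $\mathrm{cn}(x)=\mathrm{cn}({*}{:}x)=\{x\}$): $\langle\mathtt{withdraw}\,P\rangle_x|\Gamma\xrightarrow{x}_\sharp\Gamma$; $\langle\tau.C\rangle_x|\Gamma\xrightarrow{x}_\sharp\langle C\rangle_y|\Gamma$, $y$ fresh; $\langle\mathtt{split}\,\|_i(\to C_i)\rangle_x|\Gamma\xrightarrow{x}_\sharp\|_i\langle C_i\rangle_{y_i}|\Gamma$, $y_i$ fresh; if $\langle D\rangle_x|\Gamma\xrightarrow{\ell}_\sharp\Gamma'$ and $x\in\mathrm{cn}(\ell)$ then $\langle D+C\rangle_x|\Gamma\xrightarrow{\ell}_\sharp\Gamma'$ and $\langle{*}{:}D\rangle_x|\Gamma\xrightarrow{{*}:\ell}_\sharp\Gamma'$;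 if $\mathsf X=_\sharp C$ then $\langle{*}{:}\mathtt{rngt}\,\mathsf X\rangle_x|\Gamma\xrightarrow{{*}:x}_\sharp\langle C\rangle_y|\mathsf X|\Gamma$, $y$ fresh. $\mathcal L^\sharp$ is the set of labels of the form $x$. **Origin and descendants.** For a run $\mathcal R$ from $\Gamma$, the partial function $\mathrm{orig}_\Gamma$ is: $\mathrm{orig}_\Gamma(\Gamma,x)=x$ if $x\in\mathrm{cn}(\Gamma)$; and, if $\Gamma_{\mathcal R}$ is the last configuration of $\mathcal R$, $\mathrm{orig}_\Gamma(\mathcal R\xrightarrow{\ell}\Gamma',x)$ equals $\mathrm{orig}_\Gamma(\mathcal R,x)$ if $x\in\mathrm{cn}(\Gamma_{\mathcal R})\cap\mathrm{cn}(\Gamma')$, and equals $\mathrm{orig}_\Gamma(\mathcal R,y)$ if $x\in\mathrm{cn}(\Gamma')\setminus\mathrm{cn}(\Gamma_{\mathcal R})$ and $\{y\}=\mathrm{cn}(\Gamma_{\mathcal R})\setminus\mathrm{cn}(\Gamma')$; undefined otherwise. For $\mathcal R=\Gamma\to_\flat^*\Gamma'$ and a set of names $\mathcal X$, $\mathrm{desc}_\Gamma(\mathcal R,\mathcal X)=\{x\in\mathrm{cn}(\Gamma')\mid\mathrm{orig}_\Gamma(\mathcal R,x)\in\mathcal X\}$.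
   Formalization: Fresh names chosen in the abstract run must avoid all names occurring in Γ, not only those kept by the abstraction (otherwise a name of another participant's deposit could be chosen and the claim fails); a split of total weight 0 gives its branches value 0. *)

theory Defs
  imports Complex_Main "HOL-Library.Multiset"
begin

text \<open>
  Type variables: \<open>'p\<close> participants, \<open>'n\<close> names (of deposits and of contracts), \<open>'d\<close> deposit
  variables, \<open>'s\<close> secret names, \<open>'r\<close> recursion variables, \<open>'b\<close> integer variables.
  Syntax is parametric in the type \<open>'e\<close> of static expressions, which is always instantiated
  with \<open>'b sexp\<close>; evaluating the static expressions of a contract is then an instance of the
  map function of the datatype.  Likewise the set functions of the datatypes give the occurring
  participants, names, secrets, \<open>\<dots>\<close>, and their map functions give renamings.
\<close>

section \<open>Syntax\<close>

datatype (ivars: 'b) sexp =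
    Const int
  | IVar 'b
  | SAdd "'b sexp" "'b sexp"
  | SSub "'b sexp" "'b sexp"
  | SMul "'b sexp" "'b sexp"

primrec seval :: "('b \<Rightarrow> int) \<Rightarrow> 'b sexp \<Rightarrow> int" where
  "seval \<rho> (Const k) = k"
| "seval \<rho> (IVar b) = \<rho> b"
| "seval \<rho> (SAdd e f) = seval \<rho> e + seval \<rho> f"
| "seval \<rho> (SSub e f) = seval \<rho> e - seval \<rho> f"
| "seval \<rho> (SMul e f) = seval \<rho> e * seval \<rho> f"

text \<open>The value of a closed expression; the environment is then irrelevant.\<close>

definition sval :: "'b sexp \<Rightarrow> int" where
  "sval e = seval (\<lambda>_. 0) e"

datatype (x_secs: 's, x_exps: 'e) pexp =
    Static 'e
  | SecretVal 's
  | PAdd "('s, 'e) pexp" "('s, 'e) pexp"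
  | PSub "('s, 'e) pexp" "('s, 'e) pexp"

datatype (p_secs: 's, p_exps: 'e) pred =
    PTrue
  | PAnd "('s, 'e) pred" "('s, 'e) pred"
  | PNot "('s, 'e) pred"
  | PEq "('s, 'e) pexp" "('s, 'e) pexp"
  | PLess "('s, 'e) pexp" "('s, 'e) pexp"

primrec peval :: "('s \<Rightarrow> nat) \<Rightarrow> ('s, 'b sexp) pexp \<Rightarrow> int" where
  "peval N (Static e) = sval e"
| "peval N (SecretVal a) = int (N a)"
| "peval N (PAdd E F) = peval N E + peval N F"
| "peval N (PSub E F) = peval N E - peval N F"

primrec holds :: "('s \<Rightarrow> nat) \<Rightarrow> ('s, 'b sexp) pred \<Rightarrow> bool" where
  "holds N PTrue \<longleftrightarrow> True"
| "holds N (PAnd p q) \<longleftrightarrow> holds N p \<and> holds N q"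
| "holds N (PNot p) \<longleftrightarrow> \<not> holds N p"
| "holds N (PEq E F) \<longleftrightarrow> peval N E = peval N F"
| "holds N (PLess E F) \<longleftrightarrow> peval N E < peval N F"

text \<open>
  A sum is the multiset of its summands.  \<open>Guarded Ps Es B\<close> is the undecorated guarded contract
  \<open>B\<close> under the decorations \<open>P:\<close> for \<open>P\<close> in \<open>Ps\<close> and \<open>after E:\<close> for \<open>E\<close> in \<open>Es\<close>; these are
  multisets because the order of the decorations is immaterial.  \<open>Rngt X es\<close> stands for
  \<open>*:rngt X\<langle>es\<rangle>\<close>, including the star.
\<close>

datatype (c_parts: 'p, c_secs: 's, c_rvars: 'r, c_exps: 'e) contract =
    Choice "('p, 's, 'r, 'e) guarded multiset"
and (g_parts: 'p, g_secs: 's, g_rvars: 'r, g_exps: 'e) guarded =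
    Guarded "'p multiset" "'e multiset" "('p, 's, 'r, 'e) core"
and (b_parts: 'p, b_secs: 's, b_rvars: 'r, b_exps: 'e) core =
    Withdraw 'p
  | Reveal "'s list" "('s, 'e) pred" "('p, 's, 'r, 'e) contract"
  | Split "(rat \<times> ('p, 's, 'r, 'e) contract) list"
  | Rngt 'r "'e list"

abbreviation bare :: "('p, 's, 'r, 'e) core \<Rightarrow> ('p, 's, 'r, 'e) guarded" where
  "bare B \<equiv> Guarded {#} {#} B"

text \<open>The metavariable \<open>\<chi>\<close>: a name or a deposit variable.\<close>

datatype ('n, 'd) dref = DName 'n | DVar 'd

datatype (i_parts: 'p, i_names: 'n, i_dvars: 'd, i_secs: 's) pitem =
    Dep 'p rat "('n, 'd) dref"
  | Secret 'p 's

type_synonym ('p, 'n, 'd, 's) precond = "('p, 'n, 'd, 's) pitem multiset"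

definition parts :: "('p, 'n, 'd, 's) precond \<Rightarrow> 'p set" where
  "parts G = (\<Union>i\<in>set_mset G. i_parts i)"

definition pre_secs :: "('p, 'n, 'd, 's) precond \<Rightarrow> 's set" where
  "pre_secs G = (\<Union>i\<in>set_mset G. i_secs i)"

definition pre_dvars :: "('p, 'n, 'd, 's) precond \<Rightarrow> 'd set" where
  "pre_dvars G = (\<Union>i\<in>set_mset G. i_dvars i)"

primrec item_refs :: "('p, 'n, 'd, 's) pitem \<Rightarrow> ('n, 'd) dref multiset" where
  "item_refs (Dep P v \<chi>) = {#\<chi>#}"
| "item_refs (Secret P a) = {#}"

primrec item_value :: "('p, 'n, 'd, 's) pitem \<Rightarrow> rat" where
  "item_value (Dep P v \<chi>) = v"
| "item_value (Secret P a) = 0"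

definition pre_value :: "('p, 'n, 'd, 's) precond \<Rightarrow> rat" where
  "pre_value G = \<Sum>\<^sub># (image_mset item_value G)"

text \<open>\<open>Advert None G C\<close> is \<open>{G}C\<close>, and \<open>Advert (Some x) G C\<close> is \<open>{G}\<^sup>x C\<close>.\<close>

datatype (a_parts: 'p, a_names: 'n, a_dvars: 'd, a_secs: 's, a_rvars: 'r, a_exps: 'e) advert =
  Advert "'n option" "('p, 'n, 'd, 's) pitem multiset" "('p, 's, 'r, 'e) contract"

text \<open>The right-hand side and the formal parameters of a defining equation \<open>X(\<beta>) = {G}C\<close>.\<close>

datatype ('p, 'n, 'd, 's, 'r, 'b) equation =
  Equation (eparams: "'b list") (epre: "('p, 'n, 'd, 's) pitem multiset")
    (ebody: "('p, 's, 'r, 'b sexp) contract")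

section \<open>Configurations\<close>

text \<open>
  The authorizations \<open>\<xi>\<close>: \<open># \<rhd> ad\<close>; \<open>x \<rhd> ad\<close>; \<open>x \<rhd> D\<close>; \<open>x,y \<rhd> \<langle>P,v\<rangle>\<close>;
  \<open>x \<rhd> \<langle>P,v\<rangle>,\<langle>P,v'\<rangle>\<close>; \<open>x \<rhd> Q\<close>; \<open>xs,i \<rhd> y\<close> (with \<open>i\<close> counted from 0).
\<close>

datatype ('p, 'n, 'd, 's, 'r, 'e) action =
    ToCommit "('p, 'n, 'd, 's, 'r, 'e) advert"
  | ToSpend 'n "('p, 'n, 'd, 's, 'r, 'e) advert"
  | ToBranch 'n "('p, 's, 'r, 'e) guarded"
  | ToJoin 'n 'n 'p rat
  | ToDivide 'n 'p rat rat
  | ToDonate 'n 'p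
  | ToDestroy "'n list" nat 'n

text \<open>In \<open>Committed P a N\<close>, the value \<open>\<bottom>\<close> is represented by \<open>None\<close>.\<close>

datatype (t_parts: 'p, t_names: 'n, t_dvars: 'd, t_secs: 's, t_rvars: 'r, t_exps: 'e) conf_term =
    Adv "('p, 'n, 'd, 's, 'r, 'e) advert"
  | Active "('p, 's, 'r, 'e) contract" rat 'n
  | Deposit 'p rat 'n
  | Auth 'p "('p, 'n, 'd, 's, 'r, 'e) action"
  | Committed 'p 's "nat option"
  | Revealed 'p 's nat
  | Bind 'p 'd 'n
  | Time int

type_synonym ('p, 'n, 'd, 's, 'r, 'b) config =
  "('p, 'n, 'd, 's, 'r, 'b sexp) conf_term multiset"

definition names :: "('p, 'n, 'd, 's, 'r, 'b) config \<Rightarrow> 'n set" where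
  "names \<Gamma> = (\<Union>u\<in>set_mset \<Gamma>. t_names u)"

definition secs :: "('p, 'n, 'd, 's, 'r, 'b) config \<Rightarrow> 's set" where
  "secs \<Gamma> = (\<Union>u\<in>set_mset \<Gamma>. t_secs u)"

definition dvars :: "('p, 'n, 'd, 's, 'r, 'b) config \<Rightarrow> 'd set" where
  "dvars \<Gamma> = (\<Union>u\<in>set_mset \<Gamma>. t_dvars u)"

definition cn :: "('p, 'n, 'd, 's, 'r, 'b) config \<Rightarrow> 'n set" where
  "cn \<Gamma> = {x. \<exists>C v. Active C v x \<in># \<Gamma>}"

text \<open>The subscript of a term \<open>\<langle>\<dots>\<rangle>\<^sub>x\<close>, if it has one.\<close>

fun located_at :: "('p, 'n, 'd, 's, 'r, 'e) conf_term \<Rightarrow> 'n option" where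
  "located_at (Active C v x) = Some x"
| "located_at (Deposit P v x) = Some x"
| "located_at _ = None"

fun is_auth :: "('p, 'n, 'd, 's, 'r, 'e) conf_term \<Rightarrow> bool" where
  "is_auth (Auth P \<xi>) = True"
| "is_auth _ = False"

fun is_time :: "('p, 'n, 'd, 's, 'r, 'e) conf_term \<Rightarrow> bool" where
  "is_time (Time t) = True"
| "is_time _ = False"

fun is_deposit :: "('p, 'n, 'd, 's, 'r, 'e) conf_term \<Rightarrow> bool" where
  "is_deposit (Deposit P v x) = True"
| "is_deposit _ = False"

definition timed :: "('p, 'n, 'd, 's, 'r, 'b) config \<Rightarrow> bool" where
  "timed \<Gamma> \<longleftrightarrow> (\<exists>t. Time t \<in># \<Gamma>)"

section \<open>Well-formed syntax\<close>

text \<open>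
  The argument \<open>ar\<close> gives the number of parameters of each recursion variable.  Rational numbers
  in the syntax have to be non-negative.
\<close>

primrec wf_contract :: "('r \<Rightarrow> nat) \<Rightarrow> ('p, 's, 'r, 'e) contract \<Rightarrow> bool"
  and wf_guarded :: "('r \<Rightarrow> nat) \<Rightarrow> ('p, 's, 'r, 'e) guarded \<Rightarrow> bool"
  and wf_core :: "('r \<Rightarrow> nat) \<Rightarrow> ('p, 's, 'r, 'e) core \<Rightarrow> bool"
where
  "wf_contract ar (Choice Ds) \<longleftrightarrow> (\<forall>ok\<in>#image_mset (wf_guarded ar) Ds. ok)"
| "wf_guarded ar (Guarded Ps Es B) \<longleftrightarrow> wf_core ar B"
| "wf_core ar (Withdraw P) \<longleftrightarrow> True"
| "wf_core ar (Reveal as p C) \<longleftrightarrow> distinct as \<and> p_secs p \<subseteq> set as \<and> wf_contract ar C"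
| "wf_core ar (Split ws) \<longleftrightarrow>
     (\<forall>(w, ok)\<in>set (map (map_prod id (wf_contract ar)) ws). 0 \<le> w \<and> ok)"
| "wf_core ar (Rngt X es) \<longleftrightarrow> length es = ar X"

definition closed_exps :: "'b sexp set \<Rightarrow> bool" where
  "closed_exps Es \<longleftrightarrow> (\<forall>e\<in>Es. ivars e = {})"

definition wf_precond :: "('p \<Rightarrow> 's set) \<Rightarrow> ('p, 'n, 'd, 's) precond \<Rightarrow> bool" where
  "wf_precond S G \<longleftrightarrow>
     G \<noteq> {#} \<and>
     (\<forall>P v \<chi>. Dep P v \<chi> \<in># G \<longrightarrow> 0 \<le> v) \<and>
     (\<forall>P a. Secret P a \<in># G \<longrightarrow> a \<in> S P) \<and>
     (\<forall>\<chi>. count (\<Sum>\<^sub># (image_mset item_refs G)) \<chi> \<le> 1)"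

section \<open>Labels\<close>

text \<open>The labels of the form \<open>P:\<dots>\<close> are those built with \<open>By\<close>.\<close>

datatype ('p, 'n, 'd, 's, 'r, 'b) plabel =
    PJoin 'n 'n
  | PDivide 'n rat rat
  | PDonate 'n 'p
  | PDestroy "'n list" nat
  | PCommit "('p, 'n, 'd, 's, 'r, 'b sexp) advert" "('p, 'n, 'd, 's, 'r, 'b) config"
  | PSpend "('p, 'n, 'd, 's, 'r, 'b sexp) advert" 'n
  | PReveal 's
  | PBranch 'n "('p, 's, 'r, 'b sexp) guarded"

datatype ('p, 'n, 'd, 's, 'r, 'b) label =
    By 'p "('p, 'n, 'd, 's, 'r, 'b) plabel"
  | LJoin 'n 'n
  | LDivide 'n rat rat
  | LDonate 'n 'p
  | LDestroy "'n list"
  | LAdv "('p, 'n, 'd, 's, 'r, 'b sexp) advert"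
  | LInit "('p, 'n, 'd, 's) precond" "('p, 's, 'r, 'b sexp) contract"
  | LWithdraw 'p rat 'n
  | LSplit 'n
  | LRev "'s list" 'n
  | LDelay int
  | LAdvRngt "('p, 'n, 'd, 's, 'r, 'b sexp) advert"
  | LRngt 'n "('p, 'n, 'd, 's) precond" "('p, 's, 'r, 'b sexp) contract"

definition labels_of :: "'p \<Rightarrow> ('p, 'n, 'd, 's, 'r, 'b) label set" where
  "labels_of A = {l. \<forall>P m. l = By P m \<longrightarrow> P = A}"

section \<open>Abstract contracts and their semantics\<close>

text \<open>
  \<open>ARngt X\<close> stands for \<open>*:rngt X\<close>.  The identification of \<open>*:*:D\<close> with \<open>*:D\<close> is implemented by
  prefixing stars only with the function \<open>astar\<close>.
\<close>

datatype ('p, 'r) acontract =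
    AChoice "('p, 'r) aguarded multiset"
and ('p, 'r) aguarded =
    AWithdraw 'p
  | ATau "('p, 'r) acontract"
  | ASplit "('p, 'r) acontract list"
  | ARngt 'r
  | AStar "('p, 'r) aguarded"

fun astar :: "('p, 'r) aguarded \<Rightarrow> ('p, 'r) aguarded" where
  "astar (AStar D) = AStar D"
| "astar (ARngt X) = ARngt X"
| "astar D = AStar D"

datatype ('p, 'n, 'r) aterm =
    AActive "('p, 'r) acontract" 'n
  | ARVar 'r

type_synonym ('p, 'n, 'r) aconfig = "('p, 'n, 'r) aterm multiset"

definition acn :: "('p, 'n, 'r) aconfig \<Rightarrow> 'n set" where
  "acn \<Gamma> = {x. \<exists>C. AActive C x \<in># \<Gamma>}"

text \<open>\<open>Plain x\<close> is the label \<open>x\<close> and \<open>Starred x\<close> is the label \<open>*:x\<close>.\<close>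

datatype 'n alabel = Plain 'n | Starred 'n

primrec lstar :: "'n alabel \<Rightarrow> 'n alabel" where
  "lstar (Plain x) = Starred x"
| "lstar (Starred x) = Starred x"

primrec lcn :: "'n alabel \<Rightarrow> 'n set" where
  "lcn (Plain x) = {x}"
| "lcn (Starred x) = {x}"

definition plain_labels :: "'n alabel set" where
  "plain_labels = range Plain"

text \<open>
  The argument \<open>Def\<close> gives the abstract defining equations.  The argument \<open>U\<close> is a set of names
  which, in addition to those of the abstract configuration, are already in use and hence never
  fresh: an abstract configuration retains only some of the names of the concrete configuration
  it is the abstraction of, and the names of the terms it discards are not fresh.
\<close>

inductive astep ::
  "('r \<Rightarrow> ('p, 'r) acontract) \<Rightarrow> 'n set \<Rightarrow>
   ('p, 'n, 'r) aconfig \<Rightarrow> 'n alabel \<Rightarrow> ('p, 'n, 'r) aconfig \<Rightarrow> bool"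
  for Def U where
  A_Withdraw:
    "astep Def U (add_mset (AActive (AChoice {#AWithdraw P#}) x) \<Gamma>) (Plain x) \<Gamma>"
| A_Tau:
    "y \<notin> U \<Longrightarrow> y \<notin> insert x (acn \<Gamma>) \<Longrightarrow>
     astep Def U (add_mset (AActive (AChoice {#ATau C#}) x) \<Gamma>) (Plain x)
       (add_mset (AActive C y) \<Gamma>)"
| A_Split:
    "length ys = length Cs \<Longrightarrow> distinct ys \<Longrightarrow> set ys \<inter> U = {} \<Longrightarrow>
     set ys \<inter> insert x (acn \<Gamma>) = {} \<Longrightarrow>
     astep Def U (add_mset (AActive (AChoice {#ASplit Cs#}) x) \<Gamma>) (Plain x)
       (mset (map2 AActive Cs ys) + \<Gamma>)"
| A_Choice:
    "astep Def U (add_mset (AActive (AChoice {#D#}) x) \<Gamma>) l \<Gamma>' \<Longrightarrow> x \<in> lcn l \<Longrightarrow>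
     astep Def U (add_mset (AActive (AChoice (add_mset D Ds)) x) \<Gamma>) l \<Gamma>'"
| A_Star:
    "astep Def U (add_mset (AActive (AChoice {#D#}) x) \<Gamma>) l \<Gamma>' \<Longrightarrow> x \<in> lcn l \<Longrightarrow>
     astep Def U (add_mset (AActive (AChoice {#astar D#}) x) \<Gamma>) (lstar l) \<Gamma>'"
| A_Rngt:
    "y \<notin> U \<Longrightarrow> y \<notin> insert x (acn \<Gamma>) \<Longrightarrow>
     astep Def U (add_mset (AActive (AChoice {#ARngt X#}) x) \<Gamma>) (Starred x)
       (add_mset (AActive (Def X) y) (add_mset (ARVar X) \<Gamma>))"

definition asteps ::
  "('r \<Rightarrow> ('p, 'r) acontract) \<Rightarrow> 'n set \<Rightarrow> 'n alabel set \<Rightarrow>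
   ('p, 'n, 'r) aconfig \<Rightarrow> ('p, 'n, 'r) aconfig \<Rightarrow> bool" where
  "asteps Def U L = (\<lambda>\<Gamma> \<Gamma>'. \<exists>l\<in>L. astep Def U \<Gamma> l \<Gamma>')\<^sup>*\<^sup>*"

section \<open>Runs, origin and descendants\<close>

datatype ('p, 'n, 'd, 's, 'r, 'b) run =
    Start "('p, 'n, 'd, 's, 'r, 'b) config"
  | Step "('p, 'n, 'd, 's, 'r, 'b) run" "('p, 'n, 'd, 's, 'r, 'b) label"
      "('p, 'n, 'd, 's, 'r, 'b) config"

primrec first_config :: "('p, 'n, 'd, 's, 'r, 'b) run \<Rightarrow> ('p, 'n, 'd, 's, 'r, 'b) config" where
  "first_config (Start \<Gamma>) = \<Gamma>"
| "first_config (Step R l \<Gamma>') = first_config R"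

primrec last_config :: "('p, 'n, 'd, 's, 'r, 'b) run \<Rightarrow> ('p, 'n, 'd, 's, 'r, 'b) config" where
  "last_config (Start \<Gamma>) = \<Gamma>"
| "last_config (Step R l \<Gamma>') = \<Gamma>'"

primrec run_labels :: "('p, 'n, 'd, 's, 'r, 'b) run \<Rightarrow> ('p, 'n, 'd, 's, 'r, 'b) label set" where
  "run_labels (Start \<Gamma>) = {}"
| "run_labels (Step R l \<Gamma>') = insert l (run_labels R)"

text \<open>The configuration the run starts from is part of the run, so it is not an argument here.\<close>

primrec orig :: "('p, 'n, 'd, 's, 'r, 'b) run \<Rightarrow> 'n \<Rightarrow> 'n option" where
  "orig (Start \<Gamma>) x = (if x \<in> cn \<Gamma> then Some x else None)"
| "orig (Step R l \<Gamma>') x =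
     (if x \<in> cn (last_config R) \<inter> cn \<Gamma>' then orig R x
      else if x \<in> cn \<Gamma>' - cn (last_config R) \<and> (\<exists>y. cn (last_config R) - cn \<Gamma>' = {y})
        then orig R (THE y. cn (last_config R) - cn \<Gamma>' = {y})
      else None)"

definition desc :: "('p, 'n, 'd, 's, 'r, 'b) run \<Rightarrow> 'n set \<Rightarrow> 'n set" where
  "desc R \<X> = {x \<in> cn (last_config R). \<exists>y\<in>\<X>. orig R x = Some y}"

section \<open>Concrete semantics and abstraction\<close>

text \<open>
  \<open>\<alpha>\<close>-equivalence with respect to secret names and deposit variables.  (In an advertisement all of
  these are bound by the precondition.)
\<close>

definition alpha_equiv ::
  "('p, 'n, 'd, 's, 'r, 'e) advert \<Rightarrow> ('p, 'n, 'd, 's, 'r, 'e) advert \<Rightarrow> bool" where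
  "alpha_equiv ad ad' \<longleftrightarrow>
     (\<exists>g f. inj_on g (a_dvars ad') \<and> inj_on f (a_secs ad') \<and>
            ad = map_advert id id g f id id ad')"

text \<open>
  What a single item of the precondition of \<open>ad\<close> contributes to the terms consumed when \<open>ad\<close> is
  stipulated, if the deposit variables are bound as in \<open>\<sigma>\<close>.
\<close>

primrec deref :: "('d \<Rightarrow> 'n) \<Rightarrow> ('n, 'd) dref \<Rightarrow> 'n" where
  "deref \<sigma> (DName x) = x"
| "deref \<sigma> (DVar d) = \<sigma> d"

fun stipulated_item ::
  "('d \<Rightarrow> 'n) \<Rightarrow> ('p, 'n, 'd, 's, 'r, 'b sexp) advert \<Rightarrow> ('p, 'n, 'd, 's) pitem \<Rightarrow>
   ('p, 'n, 'd, 's, 'r, 'b) config" where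
  "stipulated_item \<sigma> ad (Dep P v (DName x)) =
     {#Deposit P v x, Auth P (ToSpend x ad)#}"
| "stipulated_item \<sigma> ad (Dep P v (DVar d)) =
     {#Deposit P v (\<sigma> d), Bind P d (\<sigma> d), Auth P (ToSpend (\<sigma> d) ad)#}"
| "stipulated_item \<sigma> ad (Secret P a) = {#}"

definition stipulated ::
  "('d \<Rightarrow> 'n) \<Rightarrow> ('p, 'n, 'd, 's, 'r, 'b sexp) advert \<Rightarrow> ('p, 'n, 'd, 's) precond \<Rightarrow>
   ('p, 'n, 'd, 's, 'r, 'b) config" where
  "stipulated \<sigma> ad G =
     \<Sum>\<^sub># (image_mset (stipulated_item \<sigma> ad) G) +
     image_mset (\<lambda>P. Auth P (ToCommit ad)) (mset_set (parts G))"

locale bitml =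
  fixes Hon :: "'p set"
    and S :: "'p \<Rightarrow> 's set"
    and eqn :: "'r::finite \<Rightarrow> ('p, 'n, 'd, 's, 'r, 'b) equation"
  assumes infinite_names: "infinite (UNIV :: 'n set)"
    and disjoint_secrets: "P \<noteq> Q \<Longrightarrow> S P \<inter> S Q = {}"
    and distinct_params: "distinct (eparams (eqn X))"
    and params_bind: "e \<in> c_exps (ebody (eqn X)) \<Longrightarrow> ivars e \<subseteq> set (eparams (eqn X))"
    and wf_pre: "wf_precond S (epre (eqn X))"
    and wf_body: "wf_contract (\<lambda>Y. length (eparams (eqn Y))) (ebody (eqn X))"
begin

definition arity :: "'r \<Rightarrow> nat" where
  "arity X = length (eparams (eqn X))"

text \<open>Integer variables occur in defining equations only, so advertisements are closed.\<close>

fun wf_advert :: "('p, 'n, 'd, 's, 'r, 'b sexp) advert \<Rightarrow> bool" where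
  "wf_advert (Advert o' G C) \<longleftrightarrow>
     wf_precond S G \<and> wf_contract arity C \<and> closed_exps (c_exps C) \<and>
     c_secs C \<subseteq> pre_secs G \<and>
     (\<forall>P\<in>parts G \<union> c_parts C. \<exists>v \<chi>. Dep P v \<chi> \<in># G) \<and>
     (\<forall>X\<in>c_rvars C. parts (epre (eqn X)) = parts G)"

primrec wf_action :: "('p, 'n, 'd, 's, 'r, 'b sexp) action \<Rightarrow> bool" where
  "wf_action (ToCommit ad) \<longleftrightarrow> wf_advert ad"
| "wf_action (ToSpend x ad) \<longleftrightarrow> wf_advert ad"
| "wf_action (ToBranch x D) \<longleftrightarrow> wf_guarded arity D \<and> closed_exps (g_exps D)"
| "wf_action (ToJoin x y P v) \<longleftrightarrow> 0 \<le> v"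
| "wf_action (ToDivide x P v v') \<longleftrightarrow> 0 \<le> v \<and> 0 \<le> v'"
| "wf_action (ToDonate x Q) \<longleftrightarrow> True"
| "wf_action (ToDestroy xs i y) \<longleftrightarrow> i < length xs"

primrec wf_term :: "('p, 'n, 'd, 's, 'r, 'b sexp) conf_term \<Rightarrow> bool" where
  "wf_term (Adv ad) \<longleftrightarrow> wf_advert ad"
| "wf_term (Active C v x) \<longleftrightarrow> wf_contract arity C \<and> closed_exps (c_exps C) \<and> 0 \<le> v"
| "wf_term (Deposit P v x) \<longleftrightarrow> 0 \<le> v"
| "wf_term (Auth P \<xi>) \<longleftrightarrow> wf_action \<xi>"
| "wf_term (Committed P a N) \<longleftrightarrow> True"
| "wf_term (Revealed P a N) \<longleftrightarrow> True"
| "wf_term (Bind P d x) \<longleftrightarrow> True"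
| "wf_term (Time t) \<longleftrightarrow> True"

definition wf_config :: "('p, 'n, 'd, 's, 'r, 'b) config \<Rightarrow> bool" where
  "wf_config \<Gamma> \<longleftrightarrow>
     (\<forall>u\<in>#\<Gamma>. wf_term u) \<and>
     size (filter_mset is_time \<Gamma>) \<le> 1 \<and>
     (\<forall>u. is_auth u \<longrightarrow> count \<Gamma> u \<le> 1) \<and>
     (\<forall>x. size (filter_mset (\<lambda>u. located_at u = Some x) \<Gamma>) \<le> 1)"

definition initial :: "('p, 'n, 'd, 's, 'r, 'b) config \<Rightarrow> bool" where
  "initial \<Gamma> \<longleftrightarrow>
     wf_config \<Gamma> \<and> timed \<Gamma> \<and> (\<forall>u\<in>#\<Gamma>. is_deposit u \<or> is_time u)"

text \<open>The closed advertisement denoted by \<open>X\<langle>es\<rangle>\<close>, up to the choice of bound names.\<close>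

definition unfold_rngt :: "'r \<Rightarrow> 'b sexp list \<Rightarrow> ('p, 'n, 'd, 's, 'r, 'b sexp) advert" where
  "unfold_rngt X es =
     (let \<rho> = (\<lambda>b. the (map_of (zip (eparams (eqn X)) (map sval es)) b))
      in Advert None (epre (eqn X))
           (map_contract id id id (\<lambda>e. Const (seval \<rho> e)) (ebody (eqn X))))"

definition denotes ::
  "('p, 'n, 'd, 's) precond \<Rightarrow> ('p, 's, 'r, 'b sexp) contract \<Rightarrow> 'r \<Rightarrow> 'b sexp list \<Rightarrow> bool" where
  "denotes G C X es \<longleftrightarrow> alpha_equiv (Advert None G C) (unfold_rngt X es)"

text \<open>
  The rules.  Grammatical side conditions on the configurations (for instance, that a new
  advertisement is well-formed, or that an authorization is not duplicated) are not part of the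
  rules, but are imposed in \<open>cstep\<close> below.  The source of a transition is written \<open>\<Gamma>\<close> in the
  rules which only add terms; otherwise, \<open>\<Gamma>\<close> is the remaining part of the configuration and
  \<open>\<Gamma>\<^sub>0\<close> the source.
\<close>

inductive red ::
  "('p, 'n, 'd, 's, 'r, 'b) config \<Rightarrow> ('p, 'n, 'd, 's, 'r, 'b) label \<Rightarrow>
   ('p, 'n, 'd, 's, 'r, 'b) config \<Rightarrow> bool"
where
  C_AuthJoin:
    "{#Deposit P v x, Deposit P v' y#} \<subseteq># \<Gamma> \<Longrightarrow>
     red \<Gamma> (By P (PJoin x y)) (add_mset (Auth P (ToJoin x y P (v + v'))) \<Gamma>)"
| C_Join:
    "\<Gamma>\<^sub>0 = {#Deposit P v x, Deposit P v' y, Auth P (ToJoin x y P (v + v')),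
           Auth P (ToJoin y x P (v + v'))#} + \<Gamma> \<Longrightarrow>
     z \<notin> names \<Gamma>\<^sub>0 \<Longrightarrow>
     red \<Gamma>\<^sub>0 (LJoin x y) (add_mset (Deposit P (v + v') z) \<Gamma>)"
| C_AuthDivide:
    "Deposit P (v + v') x \<in># \<Gamma> \<Longrightarrow>
     red \<Gamma> (By P (PDivide x v v')) (add_mset (Auth P (ToDivide x P v v')) \<Gamma>)"
| C_Divide:
    "\<Gamma>\<^sub>0 = {#Deposit P (v + v') x, Auth P (ToDivide x P v v')#} + \<Gamma> \<Longrightarrow>
     y \<notin> names \<Gamma>\<^sub>0 \<Longrightarrow> y' \<notin> names \<Gamma>\<^sub>0 \<Longrightarrow> y \<noteq> y' \<Longrightarrow>
     red \<Gamma>\<^sub>0 (LDivide x v v') ({#Deposit P v y, Deposit P v' y'#} + \<Gamma>)"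
| C_AuthDonate:
    "Deposit P v x \<in># \<Gamma> \<Longrightarrow>
     red \<Gamma> (By P (PDonate x Q)) (add_mset (Auth P (ToDonate x Q)) \<Gamma>)"
| C_Donate:
    "\<Gamma>\<^sub>0 = {#Deposit P v x, Auth P (ToDonate x Q)#} + \<Gamma> \<Longrightarrow>
     y \<notin> names \<Gamma>\<^sub>0 \<Longrightarrow>
     red \<Gamma>\<^sub>0 (LDonate x Q) (add_mset (Deposit Q v y) \<Gamma>)"
| C_AuthDestroy:
    "length Ps = length xs \<Longrightarrow> length vs = length xs \<Longrightarrow> j < length xs \<Longrightarrow>
     mset (map (\<lambda>i. Deposit (Ps ! i) (vs ! i) (xs ! i)) [0..<length xs]) \<subseteq># \<Gamma> \<Longrightarrow>
     y \<notin> names (filter_mset (\<lambda>u. \<nexists>P i z. u = Auth P (ToDestroy xs i z)) \<Gamma>) \<Longrightarrow>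
     red \<Gamma> (By (Ps ! j) (PDestroy xs j)) (add_mset (Auth (Ps ! j) (ToDestroy xs j y)) \<Gamma>)"
| C_Destroy:
    "length Ps = length xs \<Longrightarrow> length vs = length xs \<Longrightarrow>
     \<Gamma>\<^sub>0 = mset (map (\<lambda>i. Deposit (Ps ! i) (vs ! i) (xs ! i)) [0..<length xs]) +
          mset (map (\<lambda>i. Auth (Ps ! i) (ToDestroy xs i y)) [0..<length xs]) + \<Gamma> \<Longrightarrow>
     red \<Gamma>\<^sub>0 (LDestroy xs) \<Gamma>"
| C_Adv:
    "(\<And>P v x. Dep P v (DName x) \<in># G \<Longrightarrow> Deposit P v x \<in># \<Gamma>) \<Longrightarrow>
     pre_secs G \<inter> secs \<Gamma> = {} \<Longrightarrow>
     red \<Gamma> (LAdv (Advert None G C)) (add_mset (Adv (Advert None G C)) \<Gamma>)"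
| C_AuthCommit:
    "ad = Advert o' G C \<Longrightarrow> Adv ad \<in># \<Gamma> \<Longrightarrow>
     as = {a. Secret P a \<in># G} \<Longrightarrow>
     (\<And>a M. a \<in> as \<Longrightarrow> Committed P a M \<notin># \<Gamma>) \<Longrightarrow>
     (\<And>a k. a \<in> as \<Longrightarrow> Revealed P a k \<notin># \<Gamma>) \<Longrightarrow>
     (\<And>a. P \<in> Hon \<Longrightarrow> a \<in> as \<Longrightarrow> N a \<noteq> None) \<Longrightarrow>
     ds = {d. \<exists>v. Dep P v (DVar d) \<in># G} \<Longrightarrow>
     (\<And>d x. d \<in> ds \<Longrightarrow> Bind P d x \<notin># \<Gamma>) \<Longrightarrow>
     (\<And>d v. Dep P v (DVar d) \<in># G \<Longrightarrow> Deposit P v (\<sigma> d) \<in># \<Gamma>) \<Longrightarrow>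
     inj_on \<sigma> ds \<Longrightarrow>
     (\<And>d v x. d \<in> ds \<Longrightarrow> Dep P v (DName x) \<in># G \<Longrightarrow> \<sigma> d \<noteq> x) \<Longrightarrow>
     \<Delta> = image_mset (\<lambda>a. Committed P a (N a)) (mset_set as) +
         image_mset (\<lambda>d. Bind P d (\<sigma> d)) (mset_set ds) \<Longrightarrow>
     red \<Gamma> (By P (PCommit ad \<Delta>)) (add_mset (Auth P (ToCommit ad)) (\<Delta> + \<Gamma>))"
| C_AuthInitDep:
    "ad = Advert o' G C \<Longrightarrow> Adv ad \<in># \<Gamma> \<Longrightarrow>
     (\<And>Q. Q \<in> parts G \<Longrightarrow> Auth Q (ToCommit ad) \<in># \<Gamma>) \<Longrightarrow>
     (\<exists>v. Dep P v (DName x) \<in># G) \<or>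
     (\<exists>v d. Dep P v (DVar d) \<in># G \<and> Bind P d x \<in># \<Gamma>) \<or>
     (o' = Some x \<and> P \<in> parts G) \<Longrightarrow>
     red \<Gamma> (By P (PSpend ad x)) (add_mset (Auth P (ToSpend x ad)) \<Gamma>)"
| C_Init:
    "ad = Advert None G C \<Longrightarrow>
     \<Gamma>\<^sub>0 = add_mset (Adv ad) (stipulated \<sigma> ad G + \<Gamma>) \<Longrightarrow>
     z \<notin> names \<Gamma>\<^sub>0 \<Longrightarrow>
     red \<Gamma>\<^sub>0 (LInit G C) (add_mset (Active C (pre_value G) z) \<Gamma>)"
| C_Withdraw:
    "\<Gamma>\<^sub>0 = add_mset (Active (Choice {#bare (Withdraw P)#}) v x) \<Gamma> \<Longrightarrow>
     y \<notin> names \<Gamma>\<^sub>0 \<Longrightarrow>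
     red \<Gamma>\<^sub>0 (LWithdraw P v x) (add_mset (Deposit P v y) \<Gamma>)"
| C_Split:
    "\<Gamma>\<^sub>0 = add_mset (Active (Choice {#bare (Split ws)#}) v x) \<Gamma> \<Longrightarrow>
     w = sum_list (map fst ws) \<Longrightarrow>
     length ys = length ws \<Longrightarrow> distinct ys \<Longrightarrow> set ys \<inter> names \<Gamma>\<^sub>0 = {} \<Longrightarrow>
     red \<Gamma>\<^sub>0 (LSplit x) (mset (map2 (\<lambda>(w', C) y. Active C (v * w' / w) y) ws ys) + \<Gamma>)"
  \<comment> \<open>If all weights are 0, then \<open>w = 0\<close> and the new contracts get \<open>v * 0 / 0 = 0\<close>.\<close>
| C_AuthRev:
    "red (add_mset (Committed P a (Some N)) \<Gamma>) (By P (PReveal a))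
       (add_mset (Revealed P a N) \<Gamma>)"
| C_Rev:
    "\<Delta> = image_mset (\<lambda>a. Revealed (Q a) a (N a)) (mset as) \<Longrightarrow>
     \<Gamma>\<^sub>0 = add_mset (Active (Choice {#bare (Reveal as p C)#}) v x) (\<Delta> + \<Gamma>) \<Longrightarrow>
     holds N p \<Longrightarrow> y \<notin> names \<Gamma>\<^sub>0 \<Longrightarrow>
     red \<Gamma>\<^sub>0 (LRev as y) (add_mset (Active C v y) (\<Delta> + \<Gamma>))"
| C_AuthBranch:
    "D = Guarded (add_mset P Ps) Es B \<Longrightarrow>
     Active (Choice (add_mset D Ds)) v x \<in># \<Gamma> \<Longrightarrow>
     red \<Gamma> (By P (PBranch x D)) (add_mset (Auth P (ToBranch x D)) \<Gamma>)"
  \<comment> \<open>As authorizations are never duplicated, a participant occurring several times among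
      the decorations of \<open>D\<close> provides the authorization once.\<close>
| C_Branch:
    "D = Guarded Ps Es B \<Longrightarrow>
     red (add_mset (Active (Choice {#bare B#}) v x) \<Gamma>) l \<Gamma>' \<Longrightarrow>
     x \<notin> cn \<Gamma>' \<Longrightarrow>
     (\<And>e. e \<in># Es \<Longrightarrow> sval e \<le> t) \<Longrightarrow>
     red (add_mset (Active (Choice (add_mset D Ds)) v x)
            (image_mset (\<lambda>P. Auth P (ToBranch x D)) (mset_set (set_mset Ps)) +
             add_mset (Time t) \<Gamma>)) l
       (add_mset (Time t) \<Gamma>')"
| C_Delay:
    "0 < \<delta> \<Longrightarrow> red (add_mset (Time t) \<Gamma>) (LDelay \<delta>) (add_mset (Time (t + \<delta>)) \<Gamma>)"
| C_AdvRngt: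
    "denotes G C X es \<Longrightarrow>
     pre_secs G \<inter> secs \<Gamma> = {} \<Longrightarrow> pre_dvars G \<inter> dvars \<Gamma> = {} \<Longrightarrow>
     (\<And>G' C'. Adv (Advert (Some x) G' C') \<in># \<Gamma> \<Longrightarrow> \<not> denotes G' C' X es) \<Longrightarrow>
     (\<And>P w y. Dep P w (DName y) \<in># G \<Longrightarrow> Deposit P w y \<in># \<Gamma>) \<Longrightarrow>
     Active (Choice (add_mset (bare (Rngt X es)) Ds)) v x \<in># \<Gamma> \<Longrightarrow>
     red \<Gamma> (LAdvRngt (Advert (Some x) G C)) (add_mset (Adv (Advert (Some x) G C)) \<Gamma>)"
| C_Rngt:
    "denotes G C X es \<Longrightarrow> ad = Advert (Some x) G C \<Longrightarrow>
     \<Gamma>\<^sub>0 = {#Active (Choice (add_mset (bare (Rngt X es)) Ds)) v x, Adv ad#} +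
          stipulated \<sigma> ad G +
          image_mset (\<lambda>P. Auth P (ToSpend x ad)) (mset_set (parts G)) + \<Gamma> \<Longrightarrow>
     y \<notin> names \<Gamma>\<^sub>0 \<Longrightarrow>
     red \<Gamma>\<^sub>0 (LRngt x G C) (add_mset (Active C (v + pre_value G) y) \<Gamma>)"

definition cstep ::
  "('p, 'n, 'd, 's, 'r, 'b) config \<Rightarrow> ('p, 'n, 'd, 's, 'r, 'b) label \<Rightarrow>
   ('p, 'n, 'd, 's, 'r, 'b) config \<Rightarrow> bool" where
  "cstep \<Gamma> l \<Gamma>' \<longleftrightarrow>
     wf_config \<Gamma> \<and> timed \<Gamma> \<and> wf_config \<Gamma>' \<and> timed \<Gamma>' \<and> red \<Gamma> l \<Gamma>'"

primrec is_run :: "('p, 'n, 'd, 's, 'r, 'b) run \<Rightarrow> bool" where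
  "is_run (Start \<Gamma>) \<longleftrightarrow> wf_config \<Gamma> \<and> timed \<Gamma>"
| "is_run (Step R l \<Gamma>') \<longleftrightarrow> is_run R \<and> cstep (last_config R) l \<Gamma>'"

definition reachable :: "('p, 'n, 'd, 's, 'r, 'b) config \<Rightarrow> bool" where
  "reachable \<Gamma> \<longleftrightarrow>
     (\<exists>R. is_run R \<and> initial (first_config R) \<and> last_config R = \<Gamma>)"

primrec alpha_contract :: "'p \<Rightarrow> ('p, 's, 'r, 'b sexp) contract \<Rightarrow> ('p, 'r) acontract"
  and alpha_guarded :: "'p \<Rightarrow> ('p, 's, 'r, 'b sexp) guarded \<Rightarrow> ('p, 'r) aguarded"
  and alpha_core :: "'p \<Rightarrow> ('p, 's, 'r, 'b sexp) core \<Rightarrow> ('p, 'r) aguarded"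
where
  "alpha_contract A (Choice Ds) = AChoice (image_mset (alpha_guarded A) Ds)"
| "alpha_guarded A (Guarded Ps Es B) =
     (if \<forall>P\<in>#Ps. P = A then alpha_core A B else astar (alpha_core A B))"
| "alpha_core A (Withdraw P) = AWithdraw P"
| "alpha_core A (Reveal as p C) =
     (if p = PTrue \<and> set as \<subseteq> S A then ATau (alpha_contract A C)
      else astar (ATau (alpha_contract A C)))"
| "alpha_core A (Split ws) = ASplit (map snd (map (map_prod id (alpha_contract A)) ws))"
| "alpha_core A (Rngt X es) = ARngt X"

definition alpha_eqn :: "'p \<Rightarrow> 'r \<Rightarrow> ('p, 'r) acontract" where
  "alpha_eqn A X = alpha_contract A (ebody (eqn X))"

fun alpha_term ::
  "'p \<Rightarrow> 'n set \<Rightarrow> ('p, 'n, 'd, 's, 'r, 'b sexp) conf_term \<Rightarrow> ('p, 'n, 'r) aconfig" where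
  "alpha_term A \<X> (Active C v x) = (if x \<in> \<X> then {#AActive (alpha_contract A C) x#} else {#})"
| "alpha_term A \<X> _ = {#}"

definition alpha_config ::
  "'p \<Rightarrow> 'n set \<Rightarrow> ('p, 'n, 'd, 's, 'r, 'b) config \<Rightarrow> ('p, 'n, 'r) aconfig" where
  "alpha_config A \<X> \<Gamma> = \<Sum>\<^sub># (image_mset (alpha_term A \<X>) \<Gamma>)"

end

end

theory Submission
  imports Defs
begin

text \<open>
  A plain label excludes every starred guard, so the abstract step is a withdrawal, a split or a
  reveal with trivial predicate of secrets of \<open>A\<close>, possibly decorated by \<open>A:\<close> and \<open>after\<close>.
  The participant \<open>A\<close> can perform it alone: it reveals its secrets, which it has committed to
  because the contract has been stipulated and which are not \<open>\<bottom>\<close> because \<open>A\<close> is honest, authorizes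
  the branch, lets time pass, and fires the branch.  The names chosen by the abstract run have to
  be fresh for the concrete run as well; as the abstract run is known in advance, the names of
  withdrawn deposits can be chosen outside the finite set of all names it will ever use.
\<close>

section \<open>Plain steps of the abstract semantics\<close>

text \<open>\<open>None\<close> marks the guards whose steps carry a starred label. The list holds
  one contract for each fresh name of a plain step, so that withdrawals, internal steps and splits
  become one kind of step, with zero, one or several successors.\<close>

fun continuations :: "('p, 'r) aguarded \<Rightarrow> ('p, 'r) acontract list option" where
  "continuations (AWithdraw P) = Some []"
| "continuations (ATau C) = Some [C]"
| "continuations (ASplit Cs) = Some Cs"
| "continuations _ = None"

lemma continuations_astar [simp]: "continuations (astar D) = None"
  by (cases D) auto

lemma acn_simps [simp]:
  "acn {#} = {}"
  "acn (add_mset (AActive C x) \<Gamma>) = insert x (acn \<Gamma>)"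
  "acn (add_mset (ARVar X) \<Gamma>) = acn \<Gamma>"
  "acn (\<Gamma> + \<Gamma>') = acn \<Gamma> \<union> acn \<Gamma>'"
  "acn (image_mset ARVar Xs) = {}"
  by (auto simp: acn_def)

lemma finite_acn [simp]: "finite (acn \<Gamma>)"
proof (induction \<Gamma>)
  case (add u \<Gamma>)
  then show ?case by (cases u) auto
qed simp

lemma acn_map2_AActive:
  "length ys = length Cs \<Longrightarrow> acn (mset (map2 AActive Cs ys)) = set ys"
  by (induction ys Cs rule: list_induct2) auto

lemma lstar_neq_Plain [simp]: "lstar l \<noteq> Plain x"
  by (cases l) auto

lemma astep_Plain_acn: "astep Def U \<Gamma> l \<Gamma>' \<Longrightarrow> l = Plain x \<Longrightarrow> x \<in> acn \<Gamma>"
  by (induction rule: astep.induct) auto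

text \<open>If the two terms differed, the second one would have to lie in \<open>\<Gamma>\<close>,
  which the hypothesis excludes.\<close>

lemma add_AActive_eq_iff:
  assumes "x \<notin> acn \<Gamma>"
  shows "add_mset (AActive C x) \<Gamma> = add_mset (AActive C' x) \<Gamma>' \<longleftrightarrow> C = C' \<and> \<Gamma> = \<Gamma>'"
  using assms by (auto simp: add_eq_conv_ex)

text \<open>
  The hypothesis \<open>x \<notin> acn \<Gamma>\<close> is needed because the premise of \<open>A_Choice\<close> could otherwise
  fire a different contract named \<open>x\<close>.
\<close>

lemma astep_Plain:
  assumes "astep Def U (add_mset (AActive C x) \<Gamma>) (Plain x) \<Gamma>'" and "x \<notin> acn \<Gamma>"
  shows "\<exists>D Ds Cs ys. C = AChoice (add_mset D Ds) \<and> continuations D = Some Cs \<and>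
    length ys = length Cs \<and> distinct ys \<and> set ys \<inter> U = {} \<and>
    set ys \<inter> insert x (acn \<Gamma>) = {} \<and> \<Gamma>' = mset (map2 AActive Cs ys) + \<Gamma>"
  using assms
proof (induction "add_mset (AActive C x) \<Gamma>" "Plain x" \<Gamma>' arbitrary: C \<Gamma> rule: astep.induct)
  case (A_Withdraw P \<Gamma>\<^sub>1)
  from A_Withdraw(1)[symmetric] A_Withdraw(2) show ?case
    by (intro exI[of _ "AWithdraw P"] exI[of _ "{#}"] exI[of _ "[]"] exI[of _ "[]"])
      (simp add: add_AActive_eq_iff)
next
  case (A_Tau y \<Gamma>\<^sub>1 C\<^sub>1)
  from A_Tau(3)[symmetric] A_Tau(4) have "C = AChoice {#ATau C\<^sub>1#}" "\<Gamma>\<^sub>1 = \<Gamma>"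
    by (simp_all add: add_AActive_eq_iff)
  with A_Tau show ?case
    by (intro exI[of _ "ATau C\<^sub>1"] exI[of _ "{#}"] exI[of _ "[C\<^sub>1]"] exI[of _ "[y]"]) simp
next
  case (A_Split ys Cs \<Gamma>\<^sub>1)
  from A_Split(5)[symmetric] A_Split(6) have "C = AChoice {#ASplit Cs#}" "\<Gamma>\<^sub>1 = \<Gamma>"
    by (simp_all add: add_AActive_eq_iff)
  with A_Split show ?case
    by (intro exI[of _ "ASplit Cs"] exI[of _ "{#}"] exI[of _ Cs] exI[of _ ys]) simp
next
  case (A_Choice D y \<Gamma>\<^sub>1 \<Gamma>' Ds)
  from A_Choice.hyps have [simp]: "y = x" by simp
  from A_Choice.hyps(4)[symmetric] A_Choice.prems
  have C: "C = AChoice (add_mset D Ds)" "\<Gamma>\<^sub>1 = \<Gamma>"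
    by (simp_all add: add_AActive_eq_iff)
  \<comment> \<open>The induction hypothesis concerns the singleton sum of \<open>D\<close>, so the
    guard that it yields can only be \<open>D\<close>.\<close>
  with A_Choice.hyps(2)[of "AChoice {#D#}" \<Gamma>] A_Choice.prems obtain D' Ds' Cs ys where
    "AChoice {#D#} = AChoice (add_mset D' Ds')" "continuations D' = Some Cs"
    "length ys = length Cs" "distinct ys" "set ys \<inter> U = {}"
    "set ys \<inter> insert x (acn \<Gamma>) = {}" "\<Gamma>' = mset (map2 AActive Cs ys) + \<Gamma>"
    by auto
  with C show ?case
    by (intro exI[of _ D] exI[of _ Ds] exI[of _ Cs] exI[of _ ys]) simp
\<comment> \<open>The remaining rules \<open>A_Star\<close> and \<open>A_Rngt\<close> produce
  starred labels.\<close>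
qed (metis lstar_neq_Plain)+

section \<open>Configurations\<close>

fun is_active :: "('p, 'n, 'd, 's, 'r, 'e) conf_term \<Rightarrow> bool" where
  "is_active (Active C v x) = True"
| "is_active _ = False"

fun is_revealed :: "('p, 'n, 'd, 's, 'r, 'e) conf_term \<Rightarrow> bool" where
  "is_revealed (Revealed P a N) = True"
| "is_revealed _ = False"

lemma names_simps [simp]:
  "names {#} = {}"
  "names (add_mset u \<Gamma>) = t_names u \<union> names \<Gamma>"
  "names (\<Gamma> + \<Gamma>') = names \<Gamma> \<union> names \<Gamma>'"
  by (auto simp: names_def)

lemma names_memberI: "u \<in># \<Gamma> \<Longrightarrow> x \<in> t_names u \<Longrightarrow> x \<in> names \<Gamma>"
  by (auto simp: names_def)

lemma finite_names:
  fixes \<Gamma> :: "('p, 'n, 'd, 's, 'r, 'b) config"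
  shows "finite (names \<Gamma>)"
proof -
  have "finite (t_names u)" if "u \<in># \<Gamma>" for u
  proof -
    have adv: "finite (a_names ad)" for ad :: "('p, 'n, 'd, 's, 'r, 'b sexp) advert"
    proof -
      have item: "finite (i_names i)" for i :: "('p, 'n, 'd, 's) pitem"
      proof (cases i)
        case (Dep P v \<chi>)
        then show ?thesis by (cases \<chi>) auto
      qed auto
      show ?thesis by (cases ad) (auto simp: item)
    qed
    show ?thesis
    proof (cases u)
      case (Auth P \<xi>)
      then show ?thesis by (cases \<xi>) (simp_all add: adv)
    qed (simp_all add: adv)
  qed
  then show ?thesis by (auto simp: names_def)
qed

lemma cn_simps [simp]:
  "cn {#} = {}"
  "cn (add_mset (Active C v x) \<Gamma>) = insert x (cn \<Gamma>)"
  "cn (\<Gamma> + \<Gamma>') = cn \<Gamma> \<union> cn \<Gamma>'"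
  by (auto simp: cn_def)

lemma cn_add_inactive [simp]: "\<not> is_active u \<Longrightarrow> cn (add_mset u \<Gamma>) = cn \<Gamma>"
  by (cases u) (auto simp: cn_def)

lemma cn_inactive: "(\<And>u. u \<in># \<Gamma> \<Longrightarrow> \<not> is_active u) \<Longrightarrow> cn \<Gamma> = {}"
  by (force simp: cn_def)

lemma cn_filter_active: "cn (filter_mset is_active \<Gamma>) = cn \<Gamma>"
  by (auto simp: cn_def)

lemma cn_subset_names: "cn \<Gamma> \<subseteq> names \<Gamma>"
  by (force simp: cn_def names_def)

lemma size_filter_located:
  "size (filter_mset (\<lambda>u. located_at u = Some x) \<Gamma>) = count (image_mset located_at \<Gamma>) (Some x)"
  by (induction \<Gamma>) auto

lemma located_at_names: "located_at u = Some x \<Longrightarrow> t_names u = {x}"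
  by (cases u) auto

lemma count_located_fresh:
  assumes "x \<notin> names \<Gamma>"
  shows "count (image_mset located_at \<Gamma>) (Some x) = 0"
proof -
  have "located_at u \<noteq> Some x" if "u \<in># \<Gamma>" for u
    using assms that names_memberI located_at_names by (metis singletonI)
  then have "Some x \<notin> located_at ` set_mset \<Gamma>" by force
  then show ?thesis by (simp add: count_eq_zero_iff)
qed

section \<open>Descendants along a run\<close>

lemma desc_Start: "\<X> \<subseteq> cn \<Gamma> \<Longrightarrow> desc (Start \<Gamma>) \<X> = \<X>"
  by (auto simp: desc_def)

lemma orig_Step_kept:
  "x \<in> cn (last_config R) \<Longrightarrow> x \<in> cn \<Gamma>' \<Longrightarrow> orig (Step R l \<Gamma>') x = orig R x"
  by simp

lemma orig_Step_new:
  assumes "x \<notin> cn (last_config R)" "x \<in> cn \<Gamma>'" "cn (last_config R) - cn \<Gamma>' = {y}"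
  shows "orig (Step R l \<Gamma>') x = orig R y"
  using assms(1,2) unfolding orig.simps assms(3) by simp

lemma mem_desc_iff:
  "x \<in> desc R \<X> \<longleftrightarrow> x \<in> cn (last_config R) \<and> (\<exists>y\<in>\<X>. orig R x = Some y)"
  by (simp add: desc_def)

lemma desc_Step_same:
  assumes "cn \<Gamma>' = cn (last_config R)"
  shows "desc (Step R l \<Gamma>') \<X> = desc R \<X>"
proof (rule set_eqI)
  fix x
  show "x \<in> desc (Step R l \<Gamma>') \<X> \<longleftrightarrow> x \<in> desc R \<X>"
    unfolding mem_desc_iff last_config.simps assms
    using orig_Step_kept[of x R \<Gamma>' l] assms by auto
qed

text \<open>As \<open>x\<close> is the only name that disappears, every name in \<open>Y\<close>
  inherits its origin. Disjointness matters: a name of \<open>Y\<close> already in use would count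
  as kept and retain its own origin.\<close>

lemma desc_Step_replace:
  assumes "cn \<Gamma>' = cn (last_config R) - {x} \<union> Y" "x \<in> desc R \<X>" "Y \<inter> cn (last_config R) = {}"
  shows "desc (Step R l \<Gamma>') \<X> = desc R \<X> - {x} \<union> Y"
proof (rule set_eqI)
  fix z
  have x: "x \<in> cn (last_config R)" using assms(2) by (simp add: mem_desc_iff)
  have gone: "cn (last_config R) - cn \<Gamma>' = {x}"
    using assms(1,3) x by blast
  consider "z \<notin> cn \<Gamma>'" | "z \<in> Y" | "z \<notin> Y" "z \<in> cn \<Gamma>'" by blast
  then show "z \<in> desc (Step R l \<Gamma>') \<X> \<longleftrightarrow> z \<in> desc R \<X> - {x} \<union> Y"
  proof cases
    case 1
    then show ?thesis using assms(1) by (auto simp: mem_desc_iff simp del: orig.simps)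
  next
    case 2
    then have "orig (Step R l \<Gamma>') z = orig R x"
      using assms(1,3) by (intro orig_Step_new gone) blast+
    then show ?thesis using 2 assms(1,2) by (auto simp: mem_desc_iff simp del: orig.simps)
  next
    case 3
    then have "orig (Step R l \<Gamma>') z = orig R z"
      using assms(1) by (intro orig_Step_kept) blast+
    then show ?thesis using 3 assms(1) by (auto simp: mem_desc_iff simp del: orig.simps)
  qed
qed

context bitml
begin

section \<open>Abstraction of configurations\<close>

lemma alpha_config_simps [simp]:
  "alpha_config A \<X> {#} = {#}"
  "alpha_config A \<X> (add_mset u \<Gamma>) = alpha_term A \<X> u + alpha_config A \<X> \<Gamma>"
  "alpha_config A \<X> (\<Gamma> + \<Gamma>') = alpha_config A \<X> \<Gamma> + alpha_config A \<X> \<Gamma>'"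
  by (simp_all add: alpha_config_def)

lemma alpha_term_inactive [simp]: "\<not> is_active u \<Longrightarrow> alpha_term A \<X> u = {#}"
  by (cases u) auto

lemma alpha_config_filter_active:
  "alpha_config A \<X> (filter_mset is_active \<Gamma>) = alpha_config A \<X> \<Gamma>"
  by (induction \<Gamma>) auto

lemma alpha_config_cong:
  "(\<And>x. x \<in> cn \<Gamma> \<Longrightarrow> x \<in> \<X> \<longleftrightarrow> x \<in> \<Y>) \<Longrightarrow> alpha_config A \<X> \<Gamma> = alpha_config A \<Y> \<Gamma>"
proof (induction \<Gamma>)
  case (add u \<Gamma>)
  then show ?case by (cases u) auto
qed simp

lemma acn_alpha_config: "acn (alpha_config A \<X> \<Gamma>) = \<X> \<inter> cn \<Gamma>"
proof (induction \<Gamma>)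
  case (add u \<Gamma>)
  then show ?case by (cases u) auto
qed simp

section \<open>Well-formedness under removal and addition of terms\<close>

lemma wf_config_alt:
  "wf_config \<Gamma> \<longleftrightarrow>
     (\<forall>u\<in>#\<Gamma>. wf_term u) \<and> size (filter_mset is_time \<Gamma>) \<le> 1 \<and>
     (\<forall>u. is_auth u \<longrightarrow> count \<Gamma> u \<le> 1) \<and>
     (\<forall>x. count (image_mset located_at \<Gamma>) (Some x) \<le> 1)"
  by (simp add: wf_config_def size_filter_located)

text \<open>Apart from the conditions on single terms, well-formedness consists of upper bounds on
  counts, which are monotone under inclusion.\<close>

lemma wf_config_subset:
  assumes "wf_config \<Gamma>" "\<Gamma>' \<subseteq># \<Gamma>"
  shows "wf_config \<Gamma>'"
proof -
  have "size (filter_mset is_time \<Gamma>') \<le> size (filter_mset is_time \<Gamma>)"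
    using assms(2) by (intro size_mset_mono multiset_filter_mono)
  moreover have "count \<Gamma>' u \<le> count \<Gamma> u" for u
    using assms(2) by (rule mset_subset_eq_count)
  moreover have "count (image_mset located_at \<Gamma>') y \<le> count (image_mset located_at \<Gamma>) y" for y
    using assms(2) by (intro mset_subset_eq_count image_mset_subseteq_mono)
  ultimately show ?thesis
    using assms(1) mset_subset_eqD[OF assms(2)] unfolding wf_config_alt by (meson le_trans)
qed

lemma wf_config_add_unlocated:
  assumes "wf_config \<Gamma>" "wf_term u" "located_at u = None"
    "is_time u \<Longrightarrow> filter_mset is_time \<Gamma> = {#}" "is_auth u \<Longrightarrow> u \<notin># \<Gamma>"
  shows "wf_config (add_mset u \<Gamma>)"
  using assms by (auto simp: wf_config_alt not_in_iff)

text \<open>The number of terms located at a name is the sum of a contribution of \<open>ys\<close>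
  and one of \<open>\<Gamma>\<close>. Each is at most 1, and freshness prevents both from being
  nonzero.\<close>

lemma wf_config_add_located:
  assumes "wf_config \<Gamma>" "\<And>u. u \<in># \<Delta> \<Longrightarrow> wf_term u \<and> \<not> is_auth u \<and> \<not> is_time u"
    "image_mset located_at \<Delta> = image_mset Some (mset ys)" "distinct ys"
    "set ys \<inter> names \<Gamma> = {}"
  shows "wf_config (\<Delta> + \<Gamma>)"
proof -
  have "filter_mset is_time \<Delta> = {#}" using assms(2) by auto
  then have "size (filter_mset is_time (\<Delta> + \<Gamma>)) \<le> 1"
    using assms(1) by (simp only: wf_config_alt filter_union_mset) simp
  moreover have "count \<Delta> u = 0" if "is_auth u" for u
    using assms(2) that by (auto simp: count_eq_zero_iff)
  moreover have "count (image_mset located_at (\<Delta> + \<Gamma>)) (Some x) \<le> 1" for x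
  proof -
    have *: "count (image_mset located_at (\<Delta> + \<Gamma>)) (Some x) =
        count (mset ys) x + count (image_mset located_at \<Gamma>) (Some x)"
    proof -
      have "count (image_mset Some M) (Some x) = count M x" for M :: "'n multiset"
        by (induction M) auto
      then show ?thesis using assms(3) by simp
    qed
    show ?thesis
    proof (cases "x \<in> set ys")
      case True
      then have "count (image_mset located_at \<Gamma>) (Some x) = 0"
        using assms(5) by (intro count_located_fresh) blast
      then show ?thesis using * assms(4) by (simp add: distinct_count_atmost_1)
    next
      case False
      then have "count (mset ys) x = 0" by (simp add: count_eq_zero_iff)
      then show ?thesis using * assms(1) unfolding wf_config_alt by (metis add_0)
    qed
  qed
  ultimately show ?thesis using assms(1,2) unfolding wf_config_alt by auto
qed

lemma wf_config_active_unique: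
  assumes "wf_config (add_mset (Active C v x) \<Gamma>)"
  shows "x \<notin> cn \<Gamma>"
proof
  assume "x \<in> cn \<Gamma>"
  then obtain C' v' \<Gamma>' where "\<Gamma> = add_mset (Active C' v' x) \<Gamma>'"
    by (auto simp: cn_def dest: multi_member_split)
  then have "count (image_mset located_at (add_mset (Active C v x) \<Gamma>)) (Some x) > 1" by simp
  then show False using assms unfolding wf_config_alt by (meson not_le)
qed

section \<open>Secrets of active contracts\<close>

text \<open>The disjunction makes the property persistent, since revealing a secret consumes the
  commitment. As in \<open>C_AuthCommit\<close>, only honest participants are bound to a proper
  value.\<close>

definition available :: "('p, 'n, 'd, 's, 'r, 'b) config \<Rightarrow> 'p \<Rightarrow> 's \<Rightarrow> bool" where
  "available \<Gamma> P a \<longleftrightarrow>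
     (\<exists>N. Committed P a N \<in># \<Gamma> \<and> (P \<in> Hon \<longrightarrow> N \<noteq> None)) \<or> (\<exists>k. Revealed P a k \<in># \<Gamma>)"

text \<open>The clause for commitment authorizations carries the invariant from the commitment to
  the stipulation of the contract. Availability is a parameter \<open>K\<close> so that it can stay
  fixed while an induction on \<open>red\<close> passes to the inner step of
  \<open>C_Branch\<close>.\<close>

fun pledged :: "('p \<Rightarrow> 's \<Rightarrow> bool) \<Rightarrow> ('p, 'n, 'd, 's, 'r, 'e) conf_term \<Rightarrow> bool" where
  "pledged K (Active C v x) \<longleftrightarrow> (\<forall>a\<in>c_secs C. \<exists>P. a \<in> S P \<and> K P a)"
| "pledged K (Auth P (ToCommit (Advert o' G C))) \<longleftrightarrow> (\<forall>a. Secret P a \<in># G \<longrightarrow> K P a)"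
| "pledged K _ \<longleftrightarrow> True"

lemma stipulated_terms:
  assumes "u \<in># stipulated \<sigma> ad G"
  shows "is_auth u \<or> is_deposit u \<or> (\<exists>P d x. u = Bind P d x)"
proof -
  have "is_auth u \<or> is_deposit u \<or> (\<exists>P d x. u = Bind P d x)"
    if "u \<in># stipulated_item \<sigma> ad i" for i
    using that by (induction \<sigma> ad i rule: stipulated_item.induct) auto
  with assms show ?thesis by (auto simp: stipulated_def)
qed

lemma stipulated_available [simp]:
  "Committed P a N \<notin># stipulated \<sigma> ad G" "Revealed P a k \<notin># stipulated \<sigma> ad G"
  by (auto dest!: stipulated_terms)

lemma finite_parts [simp]: "finite (parts G)"
proof -
  have "finite (i_parts i)" for i :: "('p, 'n, 'd, 's) pitem"
    by (cases i) auto
  then show ?thesis by (auto simp: parts_def)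
qed


text \<open>The only rule that removes a commitment for good is \<open>C_AuthRev\<close>, which puts
  the revealed secret in its place; \<open>C_Rev\<close> returns the secrets that it inspects, and
  stipulation consumes none.\<close>

lemma red_available: "red \<Gamma> l \<Gamma>' \<Longrightarrow> available \<Gamma> P a \<Longrightarrow> available \<Gamma>' P a"
proof (induction rule: red.induct)
  case (C_AuthRev P a N \<Gamma>)
  then show ?case by (auto simp: available_def)
next
  case (C_Branch D Ps Es B v x \<Gamma> l \<Gamma>' t Ds)
  then have "available (add_mset (Active (Choice {#bare B#}) v x) \<Gamma>) P a"
    by (auto simp: available_def)
  with C_Branch have "available \<Gamma>' P a" by blast
  then show ?case by (auto simp: available_def)
qed (auto simp: available_def)

lemma finite_secrets: "finite {a. Secret P a \<in># G}"
proof -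
  have "Secret P ` {a. Secret P a \<in># G} \<subseteq> set_mset G" by auto
  from finite_subset[OF this finite_set_mset] show ?thesis
    by (rule finite_imageD) (simp add: inj_on_def)
qed

text \<open>Well-formedness places each secret of \<open>C\<close> in the precondition. Its owner
  there is a participant, whose commitment authorization is pledged.\<close>

lemma pledged_stipulation:
  assumes "wf_advert (Advert o' G C)"
    and "\<And>P. P \<in> parts G \<Longrightarrow> pledged K (Auth P (ToCommit (Advert o' G C)))"
  shows "pledged K (Active C v x)"
  unfolding pledged.simps
proof
  fix a assume "a \<in> c_secs C"
  with assms(1) obtain i where i: "i \<in># G" "a \<in> i_secs i" by (auto simp: pre_secs_def)
  then obtain P where P: "Secret P a \<in># G" by (cases i) auto
  then have "P \<in> parts G" by (force simp: parts_def)
  then have "K P a" using assms(2) P by simp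
  moreover have "a \<in> S P" using assms(1) P by (simp add: wf_precond_def)
  ultimately show "\<exists>P. a \<in> S P \<and> K P a" by blast
qed

text \<open>A contract obtained from another one has no new secrets, a stipulated one is covered by
  \<open>pledged_stipulation\<close>, and a new commitment authorization arrives together with the
  commitments themselves.\<close>

lemma red_pledged:
  "red \<Gamma> l \<Gamma>' \<Longrightarrow> (\<And>P a. available \<Gamma>' P a \<Longrightarrow> K P a) \<Longrightarrow>
   (\<And>u. u \<in># \<Gamma> \<Longrightarrow> wf_term u \<and> pledged K u) \<Longrightarrow> u \<in># \<Gamma>' \<Longrightarrow> pledged K u"
proof (induction arbitrary: u rule: red.induct)
  case (C_AuthCommit ad o' G C \<Gamma> as P N ds \<sigma> \<Delta>)
  have fin: "finite as" using C_AuthCommit.hyps(3) finite_secrets by simp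
  have "pledged K (Auth P (ToCommit ad))"
    unfolding C_AuthCommit.hyps(1) pledged.simps
  proof (intro allI impI)
    fix a assume "Secret P a \<in># G"
    then have a: "a \<in> as" using C_AuthCommit.hyps(3) by blast
    then have "Committed P a (N a) \<in># \<Delta>" using C_AuthCommit.hyps(12) fin by simp
    then have "available (add_mset (Auth P (ToCommit ad)) (\<Delta> + \<Gamma>)) P a"
      using C_AuthCommit.hyps(6) a by (auto simp: available_def)
    then show "K P a" by (rule C_AuthCommit.prems(1))
  qed
  moreover have "pledged K u" if "u \<in># \<Delta>" for u
    using that C_AuthCommit.hyps(12) by auto
  ultimately show ?case using C_AuthCommit.prems(2,3) by auto
next
  case (C_Init ad G C \<Gamma>\<^sub>0 \<sigma> \<Gamma> z)
  have "pledged K (Active C (pre_value G) z)"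
  proof (rule pledged_stipulation)
    show "wf_advert (Advert None G C)"
      using C_Init.prems(2)[of "Adv ad"] C_Init.hyps(1,2) by simp
    show "pledged K (Auth P (ToCommit (Advert None G C)))" if "P \<in> parts G" for P
      using C_Init.prems(2)[of "Auth P (ToCommit ad)"] C_Init.hyps(1,2) that
      by (simp add: stipulated_def)
  qed
  then show ?case using C_Init.prems(2,3) C_Init.hyps(2) by auto
next
  case (C_Split \<Gamma>\<^sub>0 ws v x \<Gamma> w ys)
  have "\<forall>a\<in>c_secs C. \<exists>P. a \<in> S P \<and> K P a" if "(w', C) \<in> set ws" for w' C
    using C_Split.prems(2)[of "Active (Choice {#bare (Split ws)#}) v x"] C_Split.hyps(1) that
    by fastforce
  then have "pledged K u" if "u \<in># mset (map2 (\<lambda>(w', C) y. Active C (v * w' / w) y) ws ys)" for u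
    using that by (auto dest!: set_zip_leftD)
  moreover have "pledged K u" if "u \<in># \<Gamma>" for u
    using that C_Split.prems(2) C_Split.hyps(1) by auto
  ultimately show ?case using C_Split.prems(3) unfolding union_iff by blast
next
  case (C_Rev \<Delta> Q N as \<Gamma>\<^sub>0 p C v x \<Gamma> y)
  have "pledged K (Active C v y)"
    using C_Rev.prems(2)[of "Active (Choice {#bare (Reveal as p C)#}) v x"] C_Rev.hyps(2) by auto
  then show ?case using C_Rev.prems(2,3) C_Rev.hyps(2) by auto
next
  case (C_Branch D Ps Es B v x \<Gamma> l \<Gamma>' t Ds)
  have x: "wf_term (Active (Choice {#bare B#}) v x) \<and> pledged K (Active (Choice {#bare B#}) v x)"
    using C_Branch.prems(2)[of "Active (Choice (add_mset D Ds)) v x"] C_Branch.hyps(1)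
    by (auto simp: closed_exps_def)
  \<comment> \<open>The induction hypothesis concerns the target without its time term, which
    contains no secrets.\<close>
  have "available (add_mset (Time t) \<Gamma>') P a" if "available \<Gamma>' P a" for P a
    using that by (auto simp: available_def)
  then have K: "K P a" if "available \<Gamma>' P a" for P a
    using that C_Branch.prems(1) by blast
  have "wf_term u \<and> pledged K u" if "u \<in># add_mset (Active (Choice {#bare B#}) v x) \<Gamma>" for u
    using C_Branch.prems(2)[of u] that x by (cases "u \<in># \<Gamma>") simp_all
  then have "pledged K u" if "u \<in># \<Gamma>'" for u
    using C_Branch.IH K that by blast
  then show ?case using C_Branch.prems(3) by auto
next
  case (C_Rngt G C X es ad x \<Gamma>\<^sub>0 Ds v \<sigma> \<Gamma> y)
  have "pledged K (Active C (v + pre_value G) y)"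
  proof (rule pledged_stipulation)
    show "wf_advert (Advert (Some x) G C)"
      using C_Rngt.prems(2)[of "Adv ad"] C_Rngt.hyps(2,3) by simp
    show "pledged K (Auth P (ToCommit (Advert (Some x) G C)))" if "P \<in> parts G" for P
      using C_Rngt.prems(2)[of "Auth P (ToCommit ad)"] C_Rngt.hyps(2,3) that
      by (simp add: stipulated_def)
  qed
  then show ?case using C_Rngt.prems(2,3) C_Rngt.hyps(3) by auto
qed auto

definition secrets_pledged :: "('p, 'n, 'd, 's, 'r, 'b) config \<Rightarrow> bool" where
  "secrets_pledged \<Gamma> \<longleftrightarrow> (\<forall>u\<in>#\<Gamma>. pledged (available \<Gamma>) u)"

lemma pledged_mono:
  "pledged K u \<Longrightarrow> (\<And>P a. K P a \<Longrightarrow> K' P a) \<Longrightarrow> pledged K' u"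
  by (induction K u rule: pledged.induct) fastforce+

lemma cstep_secrets_pledged:
  assumes "cstep \<Gamma> l \<Gamma>'" "secrets_pledged \<Gamma>"
  shows "secrets_pledged \<Gamma>'"
  unfolding secrets_pledged_def
proof
  fix u assume "u \<in># \<Gamma>'"
  moreover have "red \<Gamma> l \<Gamma>'" using assms(1) by (simp add: cstep_def)
  \<comment> \<open>Availability persists, so the source satisfies the invariant even for the
    availability of the target, the \<open>K\<close> of \<open>red_pledged\<close>.\<close>
  moreover have "wf_term u \<and> pledged (available \<Gamma>') u" if "u \<in># \<Gamma>" for u
    using that assms red_available[OF \<open>red \<Gamma> l \<Gamma>'\<close>]
    by (auto simp: cstep_def wf_config_def secrets_pledged_def intro: pledged_mono)
  ultimately show "pledged (available \<Gamma>') u" using red_pledged by blast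
qed

lemma is_run_last: "is_run R \<Longrightarrow> wf_config (last_config R) \<and> timed (last_config R)"
  by (cases R) (auto simp: cstep_def)

lemma run_secrets_pledged:
  "is_run R \<Longrightarrow> secrets_pledged (first_config R) \<Longrightarrow> secrets_pledged (last_config R)"
  by (induction R) (auto intro: cstep_secrets_pledged)

text \<open>Deposits and time terms are pledged trivially, so the invariant holds initially.\<close>

lemma reachable_secrets_pledged:
  assumes "reachable \<Gamma>"
  shows "secrets_pledged \<Gamma>"
proof -
  obtain R where R: "is_run R" "initial (first_config R)" "last_config R = \<Gamma>"
    using assms by (auto simp: reachable_def)
  have "pledged K u" if "is_deposit u \<or> is_time u" for K and u :: "('p, 'n, 'd, 's, 'r, 'b sexp) conf_term"
    using that by (cases u) auto
  then have "secrets_pledged (first_config R)"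
    using R(2) by (auto simp: initial_def secrets_pledged_def)
  with R run_secrets_pledged show ?thesis by blast
qed

text \<open>The invariant provides some owner of the secret; disjointness of the sets
  \<open>S P\<close> identifies this owner with \<open>A\<close>.\<close>

lemma secrets_pledgedD:
  assumes "secrets_pledged \<Gamma>" "Active C v x \<in># \<Gamma>" "a \<in> c_secs C" "a \<in> S A"
  shows "available \<Gamma> A a"
proof -
  obtain P where "a \<in> S P" "available \<Gamma> P a"
    using assms unfolding secrets_pledged_def by (metis pledged.simps(1))
  then show ?thesis using assms(4) disjoint_secrets[of P A] by blast
qed

section \<open>Preparing and firing a branch\<close>

text \<open>
  A preparatory step of \<open>A\<close> leaves the active contracts alone.  The only name occurring in a term
  it adds is that of the contract whose branch is authorized by \<open>u\<^sub>0\<close>.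
\<close>

definition prep ::
  "'p \<Rightarrow> ('p, 'n, 'd, 's, 'r, 'b sexp) conf_term \<Rightarrow>
   ('p, 'n, 'd, 's, 'r, 'b) config \<Rightarrow> ('p, 'n, 'd, 's, 'r, 'b) config \<Rightarrow> bool" where
  "prep A u\<^sub>0 \<Gamma> \<Gamma>' \<longleftrightarrow>
     (\<exists>l\<in>labels_of A. cstep \<Gamma> l \<Gamma>') \<and>
     filter_mset is_active \<Gamma>' = filter_mset is_active \<Gamma> \<and>
     (\<forall>u\<in>#\<Gamma>'. u \<in># \<Gamma> \<or> t_names u = {} \<or> u = u\<^sub>0) \<and>
     (\<forall>u\<in>#\<Gamma>. is_revealed u \<or> is_auth u \<longrightarrow> u \<in># \<Gamma>')"

lemma preps_props:
  assumes "(prep A u\<^sub>0)\<^sup>*\<^sup>* \<Gamma> \<Gamma>'"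
  shows "filter_mset is_active \<Gamma>' = filter_mset is_active \<Gamma>"
    and "u \<in># \<Gamma>' \<Longrightarrow> u \<in># \<Gamma> \<or> t_names u = {} \<or> u = u\<^sub>0"
    and "u \<in># \<Gamma> \<Longrightarrow> is_revealed u \<or> is_auth u \<Longrightarrow> u \<in># \<Gamma>'"
    and "available \<Gamma> P a \<Longrightarrow> available \<Gamma>' P a"
    and "wf_config \<Gamma> \<and> timed \<Gamma> \<Longrightarrow> wf_config \<Gamma>' \<and> timed \<Gamma>'"
    and "is_active u \<Longrightarrow> u \<in># \<Gamma>' \<longleftrightarrow> u \<in># \<Gamma>"
proof -
  show eq: "filter_mset is_active \<Gamma>' = filter_mset is_active \<Gamma>"
    using assms by (induction rule: rtranclp_induct) (auto simp: prep_def)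
  show "u \<in># \<Gamma>' \<Longrightarrow> u \<in># \<Gamma> \<or> t_names u = {} \<or> u = u\<^sub>0"
    using assms by (induction rule: rtranclp_induct) (auto simp: prep_def)
  show "u \<in># \<Gamma> \<Longrightarrow> is_revealed u \<or> is_auth u \<Longrightarrow> u \<in># \<Gamma>'"
    using assms by (induction rule: rtranclp_induct) (auto simp: prep_def)
  show "available \<Gamma> P a \<Longrightarrow> available \<Gamma>' P a"
    using assms by (induction rule: rtranclp_induct) (auto simp: prep_def cstep_def dest: red_available)
  show "wf_config \<Gamma> \<and> timed \<Gamma> \<Longrightarrow> wf_config \<Gamma>' \<and> timed \<Gamma>'"
    using assms by (induction rule: rtranclp_induct) (auto simp: prep_def cstep_def)
  show "is_active u \<Longrightarrow> u \<in># \<Gamma>' \<longleftrightarrow> u \<in># \<Gamma>"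
    using arg_cong[OF eq, of "\<lambda>M. u \<in># M"] by simp
qed

lemma preps_secrets_pledged:
  "(prep A u\<^sub>0)\<^sup>*\<^sup>* \<Gamma> \<Gamma>' \<Longrightarrow> secrets_pledged \<Gamma> \<Longrightarrow> secrets_pledged \<Gamma>'"
  by (induction rule: rtranclp_induct) (auto simp: prep_def intro: cstep_secrets_pledged)

lemma preps_run:
  assumes "(prep A u\<^sub>0)\<^sup>*\<^sup>* (last_config R) \<Gamma>'" "is_run R"
  shows "\<exists>R'. is_run R' \<and> first_config R' = first_config R \<and> last_config R' = \<Gamma>' \<and>
    run_labels R' \<subseteq> run_labels R \<union> labels_of A \<and> desc R' \<X> = desc R \<X>"
  using assms
proof (induction rule: rtranclp_induct)
  case base
  then show ?case by blast
next
  case (step \<Gamma>\<^sub>1 \<Gamma>\<^sub>2)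
  then obtain R' where R': "is_run R'" "first_config R' = first_config R" "last_config R' = \<Gamma>\<^sub>1"
    "run_labels R' \<subseteq> run_labels R \<union> labels_of A" "desc R' \<X> = desc R \<X>" by blast
  obtain l where l: "l \<in> labels_of A" "cstep \<Gamma>\<^sub>1 l \<Gamma>\<^sub>2"
    using step.hyps(2) by (auto simp: prep_def)
  have "cn \<Gamma>\<^sub>2 = cn (last_config R')"
    using step.hyps(2) R'(3) by (metis prep_def cn_filter_active)
  then have "desc (Step R' l \<Gamma>\<^sub>2) \<X> = desc R \<X>"
    using desc_Step_same R'(5) by metis
  with R' l show ?case by (intro exI[of _ "Step R' l \<Gamma>\<^sub>2"]) auto
qed

lemma timed_add [simp]: "timed \<Gamma> \<Longrightarrow> timed (add_mset u \<Gamma>)"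
  by (auto simp: timed_def)

text \<open>Honesty of \<open>A\<close> excludes a commitment to \<open>None\<close>, which could
  not be revealed.\<close>

lemma prep_reveal:
  assumes "wf_config \<Gamma>" "timed \<Gamma>" "available \<Gamma> A a" "A \<in> Hon"
  shows "\<exists>\<Gamma>' k. (prep A u\<^sub>0)\<^sup>*\<^sup>* \<Gamma> \<Gamma>' \<and> Revealed A a k \<in># \<Gamma>'"
proof (cases "\<exists>k. Revealed A a k \<in># \<Gamma>")
  case True
  then show ?thesis by blast
next
  case False
  then obtain N where "Committed A a (Some N) \<in># \<Gamma>"
    using assms(3,4) by (auto simp: available_def)
  then obtain \<Gamma>\<^sub>r where \<Gamma>: "\<Gamma> = add_mset (Committed A a (Some N)) \<Gamma>\<^sub>r"
    by (metis multi_member_split)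
  let ?\<Gamma>' = "add_mset (Revealed A a N) \<Gamma>\<^sub>r"
  have "wf_config \<Gamma>\<^sub>r" using assms(1) \<Gamma> by (auto intro: wf_config_subset)
  then have "wf_config ?\<Gamma>'" by (rule wf_config_add_unlocated) auto
  moreover have "timed ?\<Gamma>'" using assms(2) \<Gamma> by (auto simp: timed_def)
  ultimately have "cstep \<Gamma> (By A (PReveal a)) ?\<Gamma>'"
    using assms(1,2) C_AuthRev[of A a N \<Gamma>\<^sub>r] \<Gamma> by (simp add: cstep_def)
  then have "prep A u\<^sub>0 \<Gamma> ?\<Gamma>'"
    using \<Gamma> by (auto simp: prep_def labels_of_def)
  then show ?thesis by (metis r_into_rtranclp union_single_eq_member)
qed

lemma preps_reveal:
  assumes "wf_config \<Gamma>" "timed \<Gamma>" "\<And>a. a \<in> set as \<Longrightarrow> available \<Gamma> A a" "A \<in> Hon"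
  shows "\<exists>\<Gamma>'. (prep A u\<^sub>0)\<^sup>*\<^sup>* \<Gamma> \<Gamma>' \<and> (\<forall>a\<in>set as. \<exists>k. Revealed A a k \<in># \<Gamma>')"
  using assms(3)
proof (induction as)
  case (Cons a as)
  then obtain \<Gamma>\<^sub>1 where 1: "(prep A u\<^sub>0)\<^sup>*\<^sup>* \<Gamma> \<Gamma>\<^sub>1" "\<forall>a\<in>set as. \<exists>k. Revealed A a k \<in># \<Gamma>\<^sub>1"
    by auto
  then obtain \<Gamma>\<^sub>2 k where 2: "(prep A u\<^sub>0)\<^sup>*\<^sup>* \<Gamma>\<^sub>1 \<Gamma>\<^sub>2" "Revealed A a k \<in># \<Gamma>\<^sub>2"
    using prep_reveal[of \<Gamma>\<^sub>1 A a u\<^sub>0] preps_props(4,5)[OF 1(1)] assms Cons.prems by auto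
  have "\<exists>k. Revealed A b k \<in># \<Gamma>\<^sub>2" if "b \<in> set as" for b
    using 1(2) that preps_props(3)[OF 2(1)] by (metis is_revealed.simps(1))
  with 1 2 show ?case by (intro exI[of _ \<Gamma>\<^sub>2]) auto
qed auto

text \<open>One authorization suffices even if \<open>A\<close> occurs repeatedly in
  \<open>Ps\<close>. If it is already present, no step is made, because a duplicate would be
  ill-formed.\<close>

lemma preps_authorize:
  assumes "wf_config \<Gamma>" "timed \<Gamma>" "Active (Choice (add_mset (Guarded Ps Es B) Ds)) v x \<in># \<Gamma>"
    "\<And>P. P \<in># Ps \<Longrightarrow> P = A"
    and "Ps \<noteq> {#} \<Longrightarrow> u\<^sub>0 = Auth A (ToBranch x (Guarded Ps Es B))"
  shows "\<exists>\<Gamma>'. (prep A u\<^sub>0)\<^sup>*\<^sup>* \<Gamma> \<Gamma>' \<and> (Ps \<noteq> {#} \<longrightarrow> u\<^sub>0 \<in># \<Gamma>')"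
proof (cases "Ps = {#} \<or> u\<^sub>0 \<in># \<Gamma>")
  case True
  then show ?thesis by blast
next
  case False
  then obtain Ps' where Ps: "Ps = add_mset A Ps'"
    using assms(4) by (metis multiset_nonemptyE multi_member_split)
  have u0: "u\<^sub>0 = Auth A (ToBranch x (Guarded Ps Es B))" using assms(5) False by blast
  have "wf_term (Active (Choice (add_mset (Guarded Ps Es B) Ds)) v x)"
    using assms(1,3) by (auto simp: wf_config_def)
  then have "wf_config (add_mset u\<^sub>0 \<Gamma>)"
    using assms(1) False u0 by (intro wf_config_add_unlocated) (auto simp: closed_exps_def)
  moreover have "red \<Gamma> (By A (PBranch x (Guarded Ps Es B))) (add_mset u\<^sub>0 \<Gamma>)"
    using assms(3) C_AuthBranch[OF refl] unfolding u0 Ps by blast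
  ultimately have "cstep \<Gamma> (By A (PBranch x (Guarded Ps Es B))) (add_mset u\<^sub>0 \<Gamma>)"
    using assms(1,2) by (simp add: cstep_def)
  then have "prep A u\<^sub>0 \<Gamma> (add_mset u\<^sub>0 \<Gamma>)"
    using u0 by (auto simp: prep_def labels_of_def)
  then show ?thesis by (metis r_into_rtranclp union_single_eq_member)
qed

lemma preps_delay:
  assumes "wf_config \<Gamma>" "timed \<Gamma>"
  shows "\<exists>\<Gamma>' t. (prep A u\<^sub>0)\<^sup>*\<^sup>* \<Gamma> \<Gamma>' \<and> Time t \<in># \<Gamma>' \<and> t\<^sub>0 \<le> t"
proof -
  obtain t where t: "Time t \<in># \<Gamma>" using assms(2) by (auto simp: timed_def)
  show ?thesis
  proof (cases "t\<^sub>0 \<le> t")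
    case True
    with t show ?thesis by blast
  next
    case False
    obtain \<Gamma>\<^sub>r where \<Gamma>: "\<Gamma> = add_mset (Time t) \<Gamma>\<^sub>r" using t by (metis multi_member_split)
    have "wf_config \<Gamma>\<^sub>r" using assms(1) \<Gamma> by (auto intro: wf_config_subset)
    moreover have "filter_mset is_time \<Gamma>\<^sub>r = {#}"
      using assms(1) \<Gamma> by (simp add: wf_config_def)
    ultimately have "wf_config (add_mset (Time t\<^sub>0) \<Gamma>\<^sub>r)"
      by (intro wf_config_add_unlocated) auto
    moreover have "red \<Gamma> (LDelay (t\<^sub>0 - t)) (add_mset (Time t\<^sub>0) \<Gamma>\<^sub>r)"
      using C_Delay[of "t\<^sub>0 - t" t \<Gamma>\<^sub>r] False \<Gamma> by simp
    ultimately have "cstep \<Gamma> (LDelay (t\<^sub>0 - t)) (add_mset (Time t\<^sub>0) \<Gamma>\<^sub>r)"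
      using assms by (auto simp: cstep_def timed_def)
    then have "prep A u\<^sub>0 \<Gamma> (add_mset (Time t\<^sub>0) \<Gamma>\<^sub>r)"
      using \<Gamma> by (auto simp: prep_def labels_of_def)
    then show ?thesis by (metis r_into_rtranclp union_single_eq_member order_refl)
  qed
qed

section \<open>Firing a prepared branch\<close>

fun secrets_to_reveal :: "('p, 's, 'r, 'e) core \<Rightarrow> 's list" where
  "secrets_to_reveal (Reveal as p C) = as"
| "secrets_to_reveal _ = []"

text \<open>Here \<open>y\<^sub>0\<close> is the name of the deposit created if \<open>B\<close> is a withdrawal.\<close>

lemma fire_core:
  assumes "continuations (alpha_core A B) = Some Cs" "length ys = length Cs" "distinct ys"
    and "set ys \<inter> insert x (names \<Gamma>) = {}" "y\<^sub>0 \<notin> insert x (names \<Gamma>)"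
    and "wf_core arity B" "closed_exps (b_exps B)" "0 \<le> v"
    and rev: "\<forall>a\<in>set (secrets_to_reveal B). \<exists>k. Revealed A a k \<in># \<Gamma>"
  shows "\<exists>l \<Delta> zs. l \<in> labels_of A \<and>
    red (add_mset (Active (Choice {#bare B#}) v x) \<Gamma>) l (\<Delta> + \<Gamma>) \<and>
    (\<forall>u\<in>#\<Delta>. wf_term u \<and> \<not> is_auth u \<and> \<not> is_time u \<and> (is_active u \<or> t_names u = {y\<^sub>0})) \<and>
    cn \<Delta> = set ys \<and> (\<forall>\<Y>. set ys \<subseteq> \<Y> \<longrightarrow> alpha_config A \<Y> \<Delta> = mset (map2 AActive Cs ys)) \<and>
    image_mset located_at \<Delta> = image_mset Some (mset zs) \<and> distinct zs \<and>
    set zs \<subseteq> insert y\<^sub>0 (set ys)"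
proof (cases B)
  case (Withdraw P)
  then have "red (add_mset (Active (Choice {#bare B#}) v x) \<Gamma>) (LWithdraw P v x)
      ({#Deposit P v y\<^sub>0#} + \<Gamma>)"
    using C_Withdraw[OF refl, of y\<^sub>0 P v x \<Gamma>] assms(5) by auto
  with Withdraw assms(1,2,8) show ?thesis
    by (intro exI[of _ "LWithdraw P v x"] exI[of _ "{#Deposit P v y\<^sub>0#}"] exI[of _ "[y\<^sub>0]"])
      (auto simp: labels_of_def)
next
  case (Reveal as p C)
  with assms(1) have C: "p = PTrue" "Cs = [alpha_contract A C]"
    by (auto split: if_splits)
  with assms(2) obtain y where ys: "ys = [y]" by (cases ys) auto
  from rev Reveal obtain N where N: "\<And>a. a \<in> set as \<Longrightarrow> Revealed A a (N a) \<in># \<Gamma>"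
    by (metis secrets_to_reveal.simps(1))
  let ?\<Delta> = "image_mset (\<lambda>a. Revealed A a (N a)) (mset as)"
  \<comment> \<open>Distinct secrets give distinct terms, so that membership of each in
    \<open>\<Gamma>\<close> yields inclusion of multisets.\<close>
  have "distinct as" using assms(6) Reveal by simp
  then have "?\<Delta> = mset_set ((\<lambda>a. Revealed A a (N a)) ` set as)"
    by (simp add: mset_set_set[symmetric] image_mset_mset_set inj_on_def)
  also have "\<dots> \<subseteq># mset_set (set_mset \<Gamma>)"
    using N by (intro subset_imp_msubset_mset_set) auto
  also have "\<dots> \<subseteq># \<Gamma>" by (rule mset_set_set_mset_msubset)
  finally obtain \<Gamma>\<^sub>2 where \<Gamma>: "\<Gamma> = ?\<Delta> + \<Gamma>\<^sub>2" by (metis subset_mset.add_diff_inverse)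
  have "red (add_mset (Active (Choice {#bare B#}) v x) \<Gamma>) (LRev as y) ({#Active C v y#} + \<Gamma>)"
    using C_Rev[of ?\<Delta> "\<lambda>_. A" N as _ p C v x \<Gamma>\<^sub>2 y] assms(4) \<Gamma> C Reveal ys by auto
  with Reveal C ys assms(6-8) show ?thesis
    by (intro exI[of _ "LRev as y"] exI[of _ "{#Active C v y#}"] exI[of _ "[y]"])
      (auto simp: labels_of_def closed_exps_def)
next
  case (Split ws)
  define w where "w = sum_list (map fst ws)"
  let ?f = "\<lambda>(w', C) y. Active C (v * w' / w) y"
  have Cs: "Cs = map (\<lambda>wC. alpha_contract A (snd wC)) ws"
    using assms(1) Split by (auto simp: comp_def)
  have len: "length ys = length ws" using assms(2) Cs by simp
  have ws: "0 \<le> w'" "wf_contract arity C" "closed_exps (c_exps C)" if "(w', C) \<in> set ws" for w' C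
  proof -
    show "0 \<le> w'" "wf_contract arity C" using that assms(6) Split by auto
    show "closed_exps (c_exps C)" using that assms(7) Split by (fastforce simp: closed_exps_def)
  qed
  \<comment> \<open>This keeps the new values \<open>v * w' / w\<close> non-negative, including the
    case \<open>w = 0\<close>, where division yields 0.\<close>
  have "0 \<le> w" unfolding w_def using ws(1) by (intro sum_list_nonneg) auto
  then have good: "wf_term u \<and> is_active u" if "u \<in># mset (map2 ?f ws ys)" for u
    using that ws assms(8) by (auto dest!: set_zip_leftD)
  have loc: "image_mset located_at (mset (map2 ?f ws ys)) = image_mset Some (mset ys)"
    using len by (induction ys ws rule: list_induct2) auto
  have cn: "cn (mset (map2 ?f ws ys)) = set ys"
    using len by (induction ys ws rule: list_induct2) auto
  have alpha: "alpha_config A \<Y> (mset (map2 ?f ws ys)) = mset (map2 AActive Cs ys)"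
    if "set ys \<subseteq> \<Y>" for \<Y>
    unfolding Cs using len that by (induction ys ws rule: list_induct2) auto
  have red: "red (add_mset (Active (Choice {#bare B#}) v x) \<Gamma>) (LSplit x) (mset (map2 ?f ws ys) + \<Gamma>)"
    using C_Split[OF refl w_def len assms(3), of v x \<Gamma>] assms(4) Split by simp
  have inert: "\<not> is_auth u \<and> \<not> is_time u" if "is_active u"
    for u :: "('p, 'n, 'd, 's, 'r, 'b sexp) conf_term" using that by (cases u) auto
  have terms: "\<forall>u\<in>#mset (map2 ?f ws ys). wf_term u \<and> \<not> is_auth u \<and> \<not> is_time u \<and>
      (is_active u \<or> t_names u = {y\<^sub>0})"
    using good inert by blast
  have label: "LSplit x \<in> labels_of A" by (simp add: labels_of_def)
  have alpha': "\<forall>\<Y>. set ys \<subseteq> \<Y> \<longrightarrow>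
      alpha_config A \<Y> (mset (map2 ?f ws ys)) = mset (map2 AActive Cs ys)"
    using alpha by blast
  show ?thesis
    by (rule exI[of _ "LSplit x"], rule exI[of _ "mset (map2 ?f ws ys)"], rule exI[of _ ys])
      (intro conjI label red terms cn alpha' loc assms(3) subset_insertI)
next
  case (Rngt X es)
  with assms(1) show ?thesis by simp
qed

text \<open>The step of \<open>fire_core\<close> is lifted by \<open>C_Branch\<close>. The last
  conjunct records that the authorization is consumed: it mentions \<open>x\<close>, and if it
  remained, the abstract run could no longer reuse that name once the contract is gone.\<close>

lemma fire_branch:
  assumes "wf_config \<Gamma>" and D: "D = Guarded Ps Es B"
    and act: "Active (Choice (add_mset D Ds)) v x \<in># \<Gamma>"
    and "\<And>P. P \<in># Ps \<Longrightarrow> P = A" "Ps \<noteq> {#} \<Longrightarrow> Auth A (ToBranch x D) \<in># \<Gamma>"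
    and "Time t \<in># \<Gamma>" "\<And>e. e \<in># Es \<Longrightarrow> sval e \<le> t"
    and "\<forall>a\<in>set (secrets_to_reveal B). \<exists>k. Revealed A a k \<in># \<Gamma>"
    and "continuations (alpha_core A B) = Some Cs" "length ys = length Cs" "distinct ys"
    and ys: "set ys \<inter> names \<Gamma> = {}" and y0: "y\<^sub>0 \<notin> names \<Gamma>"
  shows "\<exists>l\<in>labels_of A. \<exists>\<Gamma>'. cstep \<Gamma> l \<Gamma>' \<and> cn \<Gamma>' = cn \<Gamma> - {x} \<union> set ys \<and>
    alpha_config A (\<Y> - {x} \<union> set ys) \<Gamma>' = mset (map2 AActive Cs ys) +
      alpha_config A \<Y> (\<Gamma> - {#Active (Choice (add_mset D Ds)) v x#}) \<and>
    (\<forall>u\<in>#\<Gamma>'. is_active u \<or> t_names u = {y\<^sub>0} \<or>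
      u \<in># \<Gamma> \<and> (Ps \<noteq> {#} \<longrightarrow> u \<noteq> Auth A (ToBranch x D)))"
proof -
  let ?K = "Active (Choice (add_mset D Ds)) v x"
  let ?auths = "image_mset (\<lambda>P. Auth P (ToBranch x D)) (mset_set (set_mset Ps))"
  obtain \<Gamma>\<^sub>1 where \<Gamma>\<^sub>1: "\<Gamma> = add_mset ?K \<Gamma>\<^sub>1" using act by (metis multi_member_split)
  then have "Time t \<in># \<Gamma>\<^sub>1" using assms(6) by simp
  then obtain \<Gamma>\<^sub>2 where \<Gamma>\<^sub>2: "\<Gamma>\<^sub>1 = add_mset (Time t) \<Gamma>\<^sub>2" by (metis multi_member_split)
  \<comment> \<open>All decorations are \<open>A\<close>, and they are collected as a set.\<close>
  have auths: "?auths = (if Ps = {#} then {#} else {#Auth A (ToBranch x D)#})"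
  proof (cases "Ps = {#}")
    case False
    then have "set_mset Ps = {A}" using assms(4) by fastforce
    then show ?thesis using False by simp
  qed simp
  have "\<exists>\<Gamma>\<^sub>r. \<Gamma>\<^sub>2 = ?auths + \<Gamma>\<^sub>r"
  proof (cases "Ps = {#}")
    case False
    then have "Auth A (ToBranch x D) \<in># \<Gamma>\<^sub>2" using assms(5) \<Gamma>\<^sub>1 \<Gamma>\<^sub>2 by simp
    then show ?thesis unfolding auths using False by (auto dest: multi_member_split)
  qed simp
  then obtain \<Gamma>\<^sub>r where \<Gamma>: "\<Gamma> = add_mset ?K (?auths + add_mset (Time t) \<Gamma>\<^sub>r)"
    using \<Gamma>\<^sub>1 \<Gamma>\<^sub>2 by auto
  have xr: "x \<notin> cn \<Gamma>\<^sub>r"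
    using wf_config_active_unique[OF assms(1)[unfolded \<Gamma>]] by (auto simp: cn_def)
  have x: "x \<in> names \<Gamma>" using \<Gamma> by simp
  have sub: "names \<Gamma>\<^sub>r \<subseteq> names \<Gamma>" using \<Gamma> by auto
  have wfK: "wf_term ?K" using assms(1) act by (auto simp: wf_config_def)
  have rev: "\<forall>a\<in>set (secrets_to_reveal B). \<exists>k. Revealed A a k \<in># \<Gamma>\<^sub>r"
    using assms(8) unfolding \<Gamma> auths by (auto split: if_splits)
  have fresh: "set ys \<inter> insert x (names \<Gamma>\<^sub>r) = {}" "y\<^sub>0 \<notin> insert x (names \<Gamma>\<^sub>r)"
    using ys y0 x sub by auto
  have wfB: "wf_core arity B" "closed_exps (b_exps B)" "0 \<le> v"
    using wfK D by (auto simp: closed_exps_def)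
  from fire_core[OF assms(9-11) fresh wfB rev] obtain l \<Delta> zs where l: "l \<in> labels_of A"
    and red: "red (add_mset (Active (Choice {#bare B#}) v x) \<Gamma>\<^sub>r) l (\<Delta> + \<Gamma>\<^sub>r)"
    and terms: "\<forall>u\<in>#\<Delta>. wf_term u \<and> \<not> is_auth u \<and> \<not> is_time u \<and>
      (is_active u \<or> t_names u = {y\<^sub>0})"
    and cn: "cn \<Delta> = set ys"
    and alpha: "\<forall>\<Y>. set ys \<subseteq> \<Y> \<longrightarrow> alpha_config A \<Y> \<Delta> = mset (map2 AActive Cs ys)"
    and zs: "image_mset located_at \<Delta> = image_mset Some (mset zs)" "distinct zs"
      "set zs \<subseteq> insert y\<^sub>0 (set ys)"
    by (elim exE conjE) (rule that)
  let ?\<Gamma>' = "add_mset (Time t) (\<Delta> + \<Gamma>\<^sub>r)"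
  have "x \<notin> set ys" using ys x by blast
  then have "red \<Gamma> l ?\<Gamma>'"
    unfolding \<Gamma> using C_Branch[OF D red _ assms(7)] xr cn by simp
  moreover have "wf_config (\<Delta> + add_mset (Time t) \<Gamma>\<^sub>r)"
  proof (rule wf_config_add_located[OF _ _ zs(1,2)])
    show "wf_config (add_mset (Time t) \<Gamma>\<^sub>r)"
      using assms(1) by (rule wf_config_subset) (simp add: \<Gamma> subset_mset.add_increasing)
    show "set zs \<inter> names (add_mset (Time t) \<Gamma>\<^sub>r) = {}"
      using zs(3) ys y0 sub by auto
  qed (use terms in blast)
  ultimately have step: "cstep \<Gamma> l ?\<Gamma>'"
    using assms(1,6) by (auto simp: cstep_def timed_def)
  have "cn ?auths = {}" by (rule cn_inactive) auto
  then have cn': "cn ?\<Gamma>' = cn \<Gamma> - {x} \<union> set ys"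
    using xr cn unfolding \<Gamma> by auto
  have "alpha_config A \<Y> ?auths = {#}" unfolding auths by simp
  \<comment> \<open>Neither \<open>x\<close> nor any of the fresh names \<open>ys\<close> belongs to
    a remaining contract.\<close>
  moreover have "alpha_config A (\<Y> - {x} \<union> set ys) \<Gamma>\<^sub>r = alpha_config A \<Y> \<Gamma>\<^sub>r"
  proof (rule alpha_config_cong)
    fix z assume "z \<in> cn \<Gamma>\<^sub>r"
    moreover from this have "z \<in> names \<Gamma>" by (intro subsetD[OF sub] subsetD[OF cn_subset_names])
    ultimately show "z \<in> \<Y> - {x} \<union> set ys \<longleftrightarrow> z \<in> \<Y>" using xr ys by blast
  qed
  ultimately have alpha': "alpha_config A (\<Y> - {x} \<union> set ys) ?\<Gamma>' =
      mset (map2 AActive Cs ys) + alpha_config A \<Y> (\<Gamma> - {#?K#})"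
    using alpha unfolding \<Gamma> by simp
  \<comment> \<open>A second copy of the authorization would contradict well-formedness of
    \<open>\<Gamma>\<close>.\<close>
  have "Ps \<noteq> {#} \<longrightarrow> u \<noteq> Auth A (ToBranch x D)" if "u \<in># \<Gamma>\<^sub>r" for u
  proof (intro impI notI)
    assume "Ps \<noteq> {#}" and u: "u = Auth A (ToBranch x D)"
    then have "count \<Gamma> u \<ge> 2" using that unfolding \<Gamma> auths
      by (simp add: Suc_le_eq)
    moreover have "count \<Gamma> u \<le> 1" using assms(1) u by (simp add: wf_config_def)
    ultimately show False by simp
  qed
  then have "is_active u \<or> t_names u = {y\<^sub>0} \<or>
      u \<in># \<Gamma> \<and> (Ps \<noteq> {#} \<longrightarrow> u \<noteq> Auth A (ToBranch x D))" if "u \<in># ?\<Gamma>'" for u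
    using that terms assms(6) \<Gamma> by auto
  with l step cn' alpha' show ?thesis by blast
qed

section \<open>Simulation\<close>

text \<open>
  The set \<open>W\<close> contains all names which the abstract run will ever use.  The last two conditions
  say that those of them which are fresh for the abstract configuration are fresh for the concrete
  one; hence the abstract run may even reuse the name of a contract that has been consumed.
\<close>

definition simulates ::
  "'p \<Rightarrow> 'n set \<Rightarrow> 'r multiset \<Rightarrow> 'n set \<Rightarrow>
   ('p, 'n, 'd, 's, 'r, 'b) run \<Rightarrow> ('p, 'n, 'r) aconfig \<Rightarrow> bool" where
  "simulates A \<X> Xs W R \<Gamma>\<^sub>a \<longleftrightarrow>
     is_run R \<and> secrets_pledged (last_config R) \<and> run_labels R \<subseteq> labels_of A \<and>
     \<Gamma>\<^sub>a = alpha_config A (desc R \<X>) (last_config R) + image_mset ARVar Xs \<and>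
     (\<forall>u\<in>#last_config R. is_active u \<or> t_names u \<inter> W \<subseteq> names (first_config R)) \<and>
     cn (last_config R) \<inter> W \<subseteq> names (first_config R) \<union> acn \<Gamma>\<^sub>a"

text \<open>The abstraction leaves a reveal unstarred only if all its secrets belong to
  \<open>A\<close>.\<close>

lemma secrets_to_reveal_own:
  "continuations (alpha_core A B) = Some Cs \<Longrightarrow> set (secrets_to_reveal B) \<subseteq> S A \<inter> b_secs B"
  by (cases B) (auto split: if_splits)

text \<open>The order is to reveal, authorize and wait. Preparatory steps preserve revealed secrets
  and authorizations, but a delay replaces the time term, so time is adjusted last.\<close>

lemma prepare_branch:
  assumes "wf_config \<Gamma>" "timed \<Gamma>" "secrets_pledged \<Gamma>" "A \<in> Hon"
    and act: "Active (Choice (add_mset D Ds)) v x \<in># \<Gamma>" and D: "D = Guarded Ps Es B"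
    and "\<And>P. P \<in># Ps \<Longrightarrow> P = A" "continuations (alpha_core A B) = Some Cs"
    and u0: "Ps \<noteq> {#} \<Longrightarrow> u\<^sub>0 = Auth A (ToBranch x D)"
  shows "\<exists>\<Gamma>' t. (prep A u\<^sub>0)\<^sup>*\<^sup>* \<Gamma> \<Gamma>' \<and> Time t \<in># \<Gamma>' \<and> (\<forall>e\<in>#Es. sval e \<le> t) \<and>
    (\<forall>a\<in>set (secrets_to_reveal B). \<exists>k. Revealed A a k \<in># \<Gamma>') \<and>
    (Ps \<noteq> {#} \<longrightarrow> Auth A (ToBranch x D) \<in># \<Gamma>')"
proof -
  let ?t = "Max (insert 0 (sval ` set_mset Es))"
  have "available \<Gamma> A a" if "a \<in> set (secrets_to_reveal B)" for a
  proof (rule secrets_pledgedD[OF assms(3) act])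
    have "a \<in> S A" "a \<in> b_secs B" using secrets_to_reveal_own[OF assms(8)] that by auto
    then show "a \<in> c_secs (Choice (add_mset D Ds))" "a \<in> S A" using D by auto
  qed
  then obtain \<Gamma>\<^sub>1 where 1: "(prep A u\<^sub>0)\<^sup>*\<^sup>* \<Gamma> \<Gamma>\<^sub>1"
    "\<And>a. a \<in> set (secrets_to_reveal B) \<Longrightarrow> \<exists>k. Revealed A a k \<in># \<Gamma>\<^sub>1"
    using preps_reveal[OF assms(1,2) _ assms(4)] by blast
  have wf1: "wf_config \<Gamma>\<^sub>1" "timed \<Gamma>\<^sub>1" using preps_props(5)[OF 1(1)] assms(1,2) by auto
  have "Active (Choice (add_mset D Ds)) v x \<in># \<Gamma>\<^sub>1"
    using preps_props(6)[OF 1(1)] act by simp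
  then obtain \<Gamma>\<^sub>2 where 2: "(prep A u\<^sub>0)\<^sup>*\<^sup>* \<Gamma>\<^sub>1 \<Gamma>\<^sub>2" "Ps \<noteq> {#} \<longrightarrow> u\<^sub>0 \<in># \<Gamma>\<^sub>2"
    using preps_authorize[OF wf1, of Ps Es B Ds v x A u\<^sub>0] assms(7) u0 D by auto
  have wf2: "wf_config \<Gamma>\<^sub>2" "timed \<Gamma>\<^sub>2" using preps_props(5)[OF 2(1)] wf1 by auto
  obtain \<Gamma>\<^sub>3 t where 3: "(prep A u\<^sub>0)\<^sup>*\<^sup>* \<Gamma>\<^sub>2 \<Gamma>\<^sub>3" "Time t \<in># \<Gamma>\<^sub>3" "?t \<le> t"
    using preps_delay[OF wf2] by blast
  have 23: "(prep A u\<^sub>0)\<^sup>*\<^sup>* \<Gamma>\<^sub>1 \<Gamma>\<^sub>3" using 2(1) 3(1) by (rule rtranclp_trans)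
  have "sval e \<le> t" if "e \<in># Es" for e
    using Max_ge[of "insert 0 (sval ` set_mset Es)" "sval e"] that 3(3) by auto
  moreover have "\<exists>k. Revealed A a k \<in># \<Gamma>\<^sub>3" if "a \<in> set (secrets_to_reveal B)" for a
    using 1(2)[OF that] preps_props(3)[OF 23] by (metis is_revealed.simps(1))
  moreover have "Ps \<noteq> {#} \<longrightarrow> Auth A (ToBranch x D) \<in># \<Gamma>\<^sub>3"
    using 2(2) u0 preps_props(3)[OF 3(1)] by (metis is_auth.simps(1))
  ultimately show ?thesis using rtranclp_trans[OF 1(1) 23] 3(2) by blast
qed

text \<open>The abstract contract named \<open>x\<close> is the image of a descendant of the same
  name, and a plain guard stems from a summand that \<open>A\<close> can prepare and fire alone. The
  concrete step takes over the names \<open>ys\<close> chosen by the abstract one; the invariant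
  makes them fresh.\<close>

lemma simulates_step:
  assumes sim: "simulates A \<X> Xs W R \<Gamma>\<^sub>a" and "A \<in> Hon"
    and astep: "astep Def (names (first_config R)) \<Gamma>\<^sub>a (Plain x) \<Gamma>\<^sub>a'"
    and W: "acn \<Gamma>\<^sub>a' \<subseteq> W" "finite W"
  shows "\<exists>R'. simulates A \<X> Xs W R' \<Gamma>\<^sub>a' \<and> first_config R' = first_config R"
proof -
  let ?\<Gamma> = "last_config R" and ?Y = "desc R \<X>" and ?U = "names (first_config R)"
  have run: "is_run R" and pledged: "secrets_pledged ?\<Gamma>" and labels: "run_labels R \<subseteq> labels_of A"
    and \<Gamma>\<^sub>a: "\<Gamma>\<^sub>a = alpha_config A ?Y ?\<Gamma> + image_mset ARVar Xs"
    and old: "\<And>u. u \<in># ?\<Gamma> \<Longrightarrow> is_active u \<or> t_names u \<inter> W \<subseteq> ?U"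
    and cnW: "cn ?\<Gamma> \<inter> W \<subseteq> ?U \<union> acn \<Gamma>\<^sub>a"
    using sim by (auto simp: simulates_def)
  have wf: "wf_config ?\<Gamma>" "timed ?\<Gamma>" using is_run_last[OF run] by auto
  have x: "x \<in> ?Y" "x \<in> cn ?\<Gamma>"
    using astep_Plain_acn[OF astep] \<Gamma>\<^sub>a by (auto simp: acn_alpha_config)
  then obtain C v \<Gamma>\<^sub>r where \<Gamma>: "?\<Gamma> = add_mset (Active C v x) \<Gamma>\<^sub>r"
    by (auto simp: cn_def dest: multi_member_split)
  define \<Theta> where "\<Theta> = alpha_config A ?Y \<Gamma>\<^sub>r + image_mset ARVar Xs"
  have xr: "x \<notin> cn \<Gamma>\<^sub>r" using wf(1) \<Gamma> wf_config_active_unique by metis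
  then have "x \<notin> acn \<Theta>" by (simp add: \<Theta>_def acn_alpha_config)
  moreover have \<Theta>: "\<Gamma>\<^sub>a = add_mset (AActive (alpha_contract A C) x) \<Theta>"
    using \<Gamma>\<^sub>a x(1) by (simp add: \<Gamma> \<Theta>_def)
  ultimately obtain D' Ds' Cs ys where
    C: "alpha_contract A C = AChoice (add_mset D' Ds')" and cont: "continuations D' = Some Cs"
    and ys: "length ys = length Cs" "distinct ys" "set ys \<inter> ?U = {}"
      "set ys \<inter> insert x (acn \<Theta>) = {}"
    and \<Gamma>\<^sub>a': "\<Gamma>\<^sub>a' = mset (map2 AActive Cs ys) + \<Theta>"
    using astep_Plain[of Def ?U "alpha_contract A C" x \<Theta> \<Gamma>\<^sub>a'] astep by auto
  obtain Ds where Ds: "C = Choice Ds" by (cases C)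
  \<comment> \<open>The summand of the abstract sum is traced back to a concrete one through the
    image multiset.\<close>
  with C obtain D Ds\<^sub>1 where D: "Ds = add_mset D Ds\<^sub>1" "D' = alpha_guarded A D"
    by (auto dest!: msed_map_invR)
  obtain Ps Es B where DB: "D = Guarded Ps Es B" by (cases D)
  \<comment> \<open>A decoration by another participant, or a starred core, would leave
    \<open>D'\<close> without continuations.\<close>
  have Ps: "\<And>P. P \<in># Ps \<Longrightarrow> P = A" and B: "continuations (alpha_core A B) = Some Cs"
    using cont D(2) DB by (auto split: if_splits)
  let ?K = "Active (Choice (add_mset D Ds\<^sub>1)) v x"
  have K: "?K \<in># ?\<Gamma>" using \<Gamma> Ds D(1) by simp
  define u\<^sub>0 :: "('p, 'n, 'd, 's, 'r, 'b sexp) conf_term"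
    where "u\<^sub>0 = (if Ps = {#} then Time 0 else Auth A (ToBranch x D))"
  have u0: "Ps \<noteq> {#} \<Longrightarrow> u\<^sub>0 = Auth A (ToBranch x D)" "t_names u\<^sub>0 \<subseteq> {x}"
    by (simp_all add: u\<^sub>0_def)
  obtain \<Gamma>\<^sub>3 t where 3: "(prep A u\<^sub>0)\<^sup>*\<^sup>* ?\<Gamma> \<Gamma>\<^sub>3" "Time t \<in># \<Gamma>\<^sub>3" "\<And>e. e \<in># Es \<Longrightarrow> sval e \<le> t"
    "\<forall>a\<in>set (secrets_to_reveal B). \<exists>k. Revealed A a k \<in># \<Gamma>\<^sub>3"
    "Ps \<noteq> {#} \<Longrightarrow> Auth A (ToBranch x D) \<in># \<Gamma>\<^sub>3"
    using prepare_branch[OF wf pledged assms(2) K DB Ps B u0(1)] by blast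
  note props = preps_props[OF 3(1)]
  have cn3: "cn \<Gamma>\<^sub>3 = cn ?\<Gamma>" using props(1) by (metis cn_filter_active)
  have acnW: "set ys \<subseteq> W"
    using W(1) unfolding \<Gamma>\<^sub>a' acn_simps acn_map2_AActive[OF ys(1)] by simp
  \<comment> \<open>A name of \<open>ys\<close> could occur in an active contract, in another
    earlier term or in \<open>u\<^sub>0\<close>. These cases are excluded by \<open>cnW\<close>, by
    \<open>old\<close> and by its being different from \<open>x\<close>.\<close>
  have fresh: "set ys \<inter> names \<Gamma>\<^sub>3 = {}"
  proof -
    have False if "y \<in> set ys" "u \<in># \<Gamma>\<^sub>3" "y \<in> t_names u" for y u
    proof -
      have y: "y \<in> W" "y \<notin> ?U" "y \<noteq> x" "y \<notin> acn \<Gamma>\<^sub>a"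
        using that(1) acnW ys(3,4) by (auto simp: \<Theta>)
      then have y': "y \<notin> cn ?\<Gamma>" using cnW by blast
      from props(2)[OF that(2)] consider "u \<in># ?\<Gamma>" | "t_names u = {}" | "u = u\<^sub>0" by blast
      then show False
      proof cases
        case 1
        show ?thesis
        proof (cases "is_active u")
          case True
          then show ?thesis using 1 that(3) y' by (cases u) (auto simp: cn_def)
        next
          case False
          then show ?thesis using old[OF 1] that(3) y by blast
        qed
      next
        case 2
        then show ?thesis using that(3) by simp
      next
        case 3
        then show ?thesis using that(3) u0(2) y(3) by blast
      qed
    qed
    then show ?thesis by (auto simp: names_def)
  qed
  have "finite (names \<Gamma>\<^sub>3 \<union> W)" using W(2) finite_names by blast
  \<comment> \<open>Staying outside \<open>W\<close> keeps the name of a withdrawn deposit from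
    colliding with any later choice of the abstract run.\<close>
  then obtain y\<^sub>0 where y0: "y\<^sub>0 \<notin> names \<Gamma>\<^sub>3" "y\<^sub>0 \<notin> W"
    using ex_new_if_finite[OF infinite_names] by blast
  have wf3: "wf_config \<Gamma>\<^sub>3" using props(5) wf by blast
  have K3: "?K \<in># \<Gamma>\<^sub>3" using props(6)[of ?K] K by simp
  obtain l \<Gamma>' where l: "l \<in> labels_of A" and step: "cstep \<Gamma>\<^sub>3 l \<Gamma>'"
    and cn': "cn \<Gamma>' = cn \<Gamma>\<^sub>3 - {x} \<union> set ys"
    and alpha': "alpha_config A (?Y - {x} \<union> set ys) \<Gamma>' =
      mset (map2 AActive Cs ys) + alpha_config A ?Y (\<Gamma>\<^sub>3 - {#?K#})"
    and terms: "\<And>u. u \<in># \<Gamma>' \<Longrightarrow> is_active u \<or> t_names u = {y\<^sub>0} \<or>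
      u \<in># \<Gamma>\<^sub>3 \<and> (Ps \<noteq> {#} \<longrightarrow> u \<noteq> Auth A (ToBranch x D))"
    using fire_branch[OF wf3 DB K3 Ps 3(5,2,3,4) B ys(1,2) fresh y0(1), of ?Y] by blast
  obtain R\<^sub>3 where R3: "is_run R\<^sub>3" "first_config R\<^sub>3 = first_config R" "last_config R\<^sub>3 = \<Gamma>\<^sub>3"
    "run_labels R\<^sub>3 \<subseteq> labels_of A" "desc R\<^sub>3 \<X> = ?Y"
    using preps_run[OF 3(1) run, of \<X>] labels by blast
  let ?R' = "Step R\<^sub>3 l \<Gamma>'"
  have desc: "desc ?R' \<X> = ?Y - {x} \<union> set ys"
  proof -
    have "set ys \<inter> cn \<Gamma>\<^sub>3 = {}" using fresh cn_subset_names[of \<Gamma>\<^sub>3] by blast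
    with cn' x(1) have "desc ?R' \<X> = desc R\<^sub>3 \<X> - {x} \<union> set ys"
      by (intro desc_Step_replace) (simp_all only: R3)
    then show ?thesis by (simp only: R3)
  qed
  have "alpha_config A ?Y (\<Gamma>\<^sub>3 - {#?K#}) = alpha_config A ?Y \<Gamma>\<^sub>r"
  proof -
    have "filter_mset is_active (\<Gamma>\<^sub>3 - {#?K#}) = filter_mset is_active (?\<Gamma> - {#?K#})"
      using props(1) by simp
    also have "\<dots> = filter_mset is_active \<Gamma>\<^sub>r" using \<Gamma> Ds D(1) by simp
    finally show ?thesis by (metis alpha_config_filter_active)
  qed
  then have alpha: "\<Gamma>\<^sub>a' = alpha_config A (desc ?R' \<X>) \<Gamma>' + image_mset ARVar Xs"
    unfolding desc alpha' \<Gamma>\<^sub>a' \<Theta>_def by simp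
  have "secrets_pledged \<Gamma>\<^sub>3"
    using 3(1) pledged by (rule preps_secrets_pledged)
  then have pledged': "secrets_pledged \<Gamma>'" using step cstep_secrets_pledged by blast
  have names': "is_active u \<or> t_names u \<inter> W \<subseteq> ?U" if "u \<in># \<Gamma>'" for u
  proof (cases "is_active u \<or> t_names u = {y\<^sub>0} \<or> t_names u = {}")
    case True
    then show ?thesis using y0(2) by auto
  next
    case False
    then have u: "u \<in># \<Gamma>\<^sub>3" "Ps \<noteq> {#} \<longrightarrow> u \<noteq> Auth A (ToBranch x D)" using terms[OF that] by auto
    \<comment> \<open>The placeholder has no names, and the actual authorization has been
      consumed.\<close>
    then have "u \<noteq> u\<^sub>0" using False by (auto simp: u\<^sub>0_def)
    then have "u \<in># ?\<Gamma>" using props(2)[OF u(1)] False by blast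
    then show ?thesis by (rule old)
  qed
  have "acn \<Gamma>\<^sub>a = insert x (acn \<Theta>)" "acn \<Gamma>\<^sub>a' = set ys \<union> acn \<Theta>"
    unfolding \<Theta> \<Gamma>\<^sub>a' acn_simps acn_map2_AActive[OF ys(1)] by simp_all
  \<comment> \<open>The name \<open>x\<close> leaves the abstract and the concrete contracts at the
    same time.\<close>
  then have "cn \<Gamma>' \<inter> W \<subseteq> ?U \<union> acn \<Gamma>\<^sub>a'" using cnW cn' cn3 by auto
  then have "simulates A \<X> Xs W ?R' \<Gamma>\<^sub>a'"
    using R3 step l pledged' names' alpha unfolding simulates_def by simp
  then show ?thesis using R3(2) by auto
qed

text \<open>The abstract run is finite and each of its configurations has finitely many names. The
  bound is built into the relation so that a later induction along the run can use it at every
  step.\<close>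

lemma asteps_finite_names:
  assumes "asteps Def U L \<Gamma>\<^sub>a \<Gamma>\<^sub>a'"
  shows "\<exists>W. finite W \<and> (\<lambda>\<Gamma> \<Gamma>'. (\<exists>l\<in>L. astep Def U \<Gamma> l \<Gamma>') \<and> acn \<Gamma>' \<subseteq> W)\<^sup>*\<^sup>* \<Gamma>\<^sub>a \<Gamma>\<^sub>a'"
  using assms unfolding asteps_def
proof (induction rule: rtranclp_induct)
  case base
  then show ?case by blast
next
  case (step \<Gamma>\<^sub>1 \<Gamma>\<^sub>2)
  then obtain W where W: "finite W"
    "(\<lambda>\<Gamma> \<Gamma>'. (\<exists>l\<in>L. astep Def U \<Gamma> l \<Gamma>') \<and> acn \<Gamma>' \<subseteq> W)\<^sup>*\<^sup>* \<Gamma>\<^sub>a \<Gamma>\<^sub>1" by blast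
  let ?W = "W \<union> acn \<Gamma>\<^sub>2"
  \<comment> \<open>Enlarging the bound does not invalidate the earlier steps.\<close>
  have "(\<lambda>\<Gamma> \<Gamma>'. (\<exists>l\<in>L. astep Def U \<Gamma> l \<Gamma>') \<and> acn \<Gamma>' \<subseteq> ?W)\<^sup>*\<^sup>* \<Gamma>\<^sub>a \<Gamma>\<^sub>1"
    using W(2) by (rule rtranclp_mono[THEN predicate2D, rotated]) blast
  then have "(\<lambda>\<Gamma> \<Gamma>'. (\<exists>l\<in>L. astep Def U \<Gamma> l \<Gamma>') \<and> acn \<Gamma>' \<subseteq> ?W)\<^sup>*\<^sup>* \<Gamma>\<^sub>a \<Gamma>\<^sub>2"
    by (rule rtranclp.rtrancl_into_rtrancl) (use step.hyps(2) in blast)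
  moreover have "finite ?W" using W(1) by simp
  ultimately show ?case by blast
qed

lemma simulation:
  assumes "A \<in> Hon" "reachable \<Gamma>" "\<X> \<subseteq> cn \<Gamma>"
    and "asteps Def (names \<Gamma>) plain_labels
           (alpha_config A \<X> \<Gamma> + image_mset ARVar Xs) \<Gamma>\<^sub>a'"
  shows "\<exists>W R. simulates A \<X> Xs W R \<Gamma>\<^sub>a' \<and> first_config R = \<Gamma>"
proof -
  obtain W where W: "finite W" and steps:
    "(\<lambda>\<Gamma>\<^sub>1 \<Gamma>\<^sub>2. (\<exists>l\<in>plain_labels. astep Def (names \<Gamma>) \<Gamma>\<^sub>1 l \<Gamma>\<^sub>2) \<and> acn \<Gamma>\<^sub>2 \<subseteq> W)\<^sup>*\<^sup>*
       (alpha_config A \<X> \<Gamma> + image_mset ARVar Xs) \<Gamma>\<^sub>a'"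
    using asteps_finite_names[OF assms(4)] by blast
  from steps have "\<exists>R. simulates A \<X> Xs W R \<Gamma>\<^sub>a' \<and> first_config R = \<Gamma>"
  proof (induction rule: rtranclp_induct)
    case base
    have "wf_config \<Gamma> \<and> timed \<Gamma>"
      using assms(2) is_run_last by (auto simp: reachable_def)
    \<comment> \<open>At the start the freshness conditions hold because every name lies in
      \<open>names \<Gamma>\<close>, which the abstract semantics treats as used throughout.\<close>
    moreover have "t_names u \<inter> W \<subseteq> names \<Gamma>" if "u \<in># \<Gamma>" for u
      using that by (auto simp: names_def)
    ultimately have "simulates A \<X> Xs W (Start \<Gamma>) (alpha_config A \<X> \<Gamma> + image_mset ARVar Xs)"
      using reachable_secrets_pledged[OF assms(2)] desc_Start[OF assms(3)] cn_subset_names[of \<Gamma>]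
      unfolding simulates_def by auto
    then show ?case by (intro exI[of _ "Start \<Gamma>"]) simp
  next
    case (step \<Gamma>\<^sub>1 \<Gamma>\<^sub>2)
    then obtain R where R: "simulates A \<X> Xs W R \<Gamma>\<^sub>1" "first_config R = \<Gamma>" by blast
    obtain x where "astep Def (names (first_config R)) \<Gamma>\<^sub>1 (Plain x) \<Gamma>\<^sub>2" "acn \<Gamma>\<^sub>2 \<subseteq> W"
      using step.hyps(2) R(2) by (auto simp: plain_labels_def)
    from simulates_step[OF R(1) assms(1) this W] R(2) show ?case by auto
  qed
  then show ?thesis by blast
qed

end

theorem theorem5p5:
  fixes Hon :: "'p set"
    and S :: "'p \<Rightarrow> 's set"
    and eqn :: "'r::finite \<Rightarrow> ('p, 'n, 'd, 's, 'r, 'b) equation"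
    and A :: 'p
    and \<Gamma> :: "('p, 'n, 'd, 's, 'r, 'b) config"
    and \<X> :: "'n set"
    and Xs :: "'r multiset"
    and \<Gamma>a' :: "('p, 'n, 'r) aconfig"
  assumes "bitml S eqn"
    and "A \<in> Hon"
    and "bitml.reachable Hon S eqn \<Gamma>"
    and "\<X> \<subseteq> cn \<Gamma>"
    and "asteps (bitml.alpha_eqn S eqn A) (names \<Gamma>) plain_labels
           (bitml.alpha_config S A \<X> \<Gamma> + image_mset ARVar Xs) \<Gamma>a'"
  shows "\<exists>R \<Gamma>'. bitml.is_run Hon S eqn R \<and> first_config R = \<Gamma> \<and> last_config R = \<Gamma>' \<and>
           run_labels R \<subseteq> labels_of A \<and>
           \<Gamma>a' = bitml.alpha_config S A (desc R \<X>) \<Gamma>' + image_mset ARVar Xs"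
proof -
  interpret bitml Hon S eqn by (rule assms(1))
  obtain W R where R: "simulates A \<X> Xs W R \<Gamma>a'" "first_config R = \<Gamma>"
    using simulation[OF assms(2-5)] by blast
  then show ?thesis unfolding simulates_def by blast
qed

end
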